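(* Let $\Gamma=(\gamma_1,\dots,\gamma_m)$ be distinct real frequencies. Let $F\in L^1_{\mathrm{loc}}([0,\infty))$ (complex valued) satisfy $$\int_0^\infty|F(y)|e^{-\varepsilon y}\,dy<\infty\qquad(\varepsilon>0),$$ and assume that the limits $$a_j=\lim_{\varepsilon\downarrow0}\varepsilon\int_0^\infty F(y)e^{-\varepsilon y}e^{-i\gamma_jy}\,dy\qquad(1\le j\le m)$$ exist. Then $$A_\infty^c(F)\ge q_\Gamma(a).$$ Moreover, $q_\Gamma(a)$ is the infimum of $A_\infty^c(F)$ over all functions $F$ constrained only by these conditions, i.e. for each $a\in\mathbb C^m$, over all $F\in L^1_{\mathrm{loc}}([0,\infty))$ satisfying the displayed integrability condition and having Abel coefficients $a_1,\dots,a_m$ at the frequencies $\Gamma$.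
   Context: For measurable $F:[0,\infty)\to\mathbb C$, $A_\infty^c(F)=\lim_{Y\to\infty}\operatorname{ess\,sup}_{y\ge Y}|F(y)|\in[0,\infty]$. With $\mathbb T=\{z\in\mathbb C:|z|=1\}$ and $\Phi_\Gamma(y)=(e^{i\gamma_1y},\dots,e^{i\gamma_my})$, let $G_\Gamma=\overline{\Phi_\Gamma(\mathbb R)}\subseteq\mathbb T^m$ be the orbit closure (a compact group) with Haar probability measure $m_\Gamma$, and let $\chi_j(z)=z_j$ be the restricted coordinate characters. Then $$q_\Gamma(a)=\inf\Bigl\{\|f\|_{L^\infty(G_\Gamma)}:\ f\in L^\infty(G_\Gamma),\ \int_{G_\Gamma}f\overline{\chi_j}\,dm_\Gamma=a_j\ (1\le j\le m)\Bigr\}.$$ *)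

theory Defs
  imports "HOL-Probability.Probability" "HOL-Probability.Essential_Supremum"
begin

text \<open>
  Frequencies are vectors in \<open>real ^ 'm\<close>, and the torus is a subset of
  \<open>complex ^ 'm\<close> (whose library multiplication is componentwise), \<open>m = CARD('m)\<close>.
\<close>

definition flow :: "real ^ 'm \<Rightarrow> real \<Rightarrow> complex ^ 'm" where
  "flow \<gamma> y = (\<chi> j. exp (\<i> * complex_of_real (\<gamma> $ j * y)))"

definition orbit_closure :: "real ^ 'm \<Rightarrow> (complex ^ 'm) set" where
  "orbit_closure \<gamma> = closure (range (flow \<gamma>))"

definition haar_probability :: "(complex ^ 'm) set \<Rightarrow> (complex ^ 'm) measure \<Rightarrow> bool" where
  "haar_probability G M \<longleftrightarrow>
     space M = G \<and> sets M = sets (restrict_space borel G) \<and> prob_space M \<and>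
     (\<forall>z\<in>G. distr M M (\<lambda>w. z * w) = M)"

text \<open>
  On a compact group, in particular on \<open>orbit_closure \<gamma>\<close>, there is exactly one
  measure satisfying \<open>haar_probability\<close>, so the choice below is no choice.
\<close>

definition haar :: "real ^ 'm \<Rightarrow> (complex ^ 'm) measure" where
  "haar \<gamma> = (SOME M. haar_probability (orbit_closure \<gamma>) M)"

definition Linf_norm :: "'a measure \<Rightarrow> ('a \<Rightarrow> complex) \<Rightarrow> ennreal" where
  "Linf_norm M f = esssup M (\<lambda>x. ennreal (cmod (f x)))"

definition q_min :: "real ^ 'm \<Rightarrow> complex ^ 'm \<Rightarrow> ennreal" where
  "q_min \<gamma> a =
     Inf {Linf_norm (haar \<gamma>) f | f.
            f \<in> borel_measurable (haar \<gamma>) \<and> Linf_norm (haar \<gamma>) f < \<infinity> \<and>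
            (\<forall>j. (LINT z|haar \<gamma>. f z * cnj (z $ j)) = a $ j)}"

text \<open>
  A function on \<open>[0,\<infinity>)\<close> is a total function on the reals whose values at negative
  arguments are irrelevant.
\<close>

definition A_inf :: "(real \<Rightarrow> complex) \<Rightarrow> ennreal" where
  "A_inf F = Lim at_top (\<lambda>Y::real. Linf_norm (restrict_space lebesgue {Y..}) F)"

definition L1_loc :: "(real \<Rightarrow> complex) \<Rightarrow> bool" where
  "L1_loc F \<longleftrightarrow> (\<forall>K. compact K \<and> K \<subseteq> {0..} \<longrightarrow> set_integrable lebesgue K F)"

definition abel_integrable :: "(real \<Rightarrow> complex) \<Rightarrow> bool" where
  "abel_integrable F \<longleftrightarrow>
     (\<forall>\<epsilon>>0. set_integrable lebesgue {0..} (\<lambda>y. cmod (F y) * exp (- \<epsilon> * y)))"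

definition has_abel_coeffs :: "real ^ 'm \<Rightarrow> (real \<Rightarrow> complex) \<Rightarrow> complex ^ 'm \<Rightarrow> bool" where
  "has_abel_coeffs \<gamma> F a \<longleftrightarrow>
     (\<forall>j. ((\<lambda>\<epsilon>::real. complex_of_real \<epsilon> *
              (LINT y:{0..}|lebesgue. F y * complex_of_real (exp (- \<epsilon> * y)) *
                 exp (- \<i> * complex_of_real (\<gamma> $ j * y))))
            \<longlongrightarrow> a $ j) (at_right 0))"

end

theory Submission
  imports Defs "HOL-Analysis.Kronecker_Approximation_Theorem"
begin

text \<open>
  Both extremal problems have the same dual. For \<open>c \<in> \<complex>\<^sup>m\<close> write \<open>p\<^sub>c = \<Sum>\<^sub>j c\<^sub>j \<chi>\<^sub>j\<close> and consider
  the condition, for a real \<open>R \<ge> 0\<close>,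

  \<open>Re (\<Sum>\<^sub>j a\<^sub>j cnj c\<^sub>j) \<le> R \<integral>\<bar>p\<^sub>c\<bar>\<close> for all \<open>c\<close>,

  where the integral is taken over the orbit closure with respect to Haar measure.

  If \<open>F\<close> has Abel coefficients \<open>a\<close> and \<open>A_inf F < R\<close>, the condition holds
  (\<open>dual_bound_of_abel_coeffs\<close>): the left side is a limit of Abel means of \<open>F\<close> against the
  conjugate of \<open>p\<^sub>c\<close> along the orbit, these are bounded by \<open>R\<close> times the Abel means of \<open>\<bar>p\<^sub>c\<bar>\<close> up to
  \<open>O(\<epsilon>)\<close>, and Abel means of continuous functions along the orbit tend to their Haar integral
  (\<open>abel_mean_flow\<close>). If \<open>f\<close> is bounded by \<open>R\<close> almost everywhere on the group and has moments
  \<open>a\<close>, the condition holds for an even simpler reason (\<open>dual_bound_of_bounded_function\<close>).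

  Conversely, the condition provides, for every \<open>\<delta> > 0\<close>, a continuous function \<open>g\<close> bounded by
  \<open>R + \<delta>\<close> on the group whose moments are exactly \<open>a\<close> (\<open>interpolation_by_duality\<close>). This follows by
  the separation of a point from a convex set in \<open>\<complex>\<^sup>m\<close>, because the moments are finitely
  many. Such a \<open>g\<close> competes in the definition of \<open>q_min\<close>, and \<open>g\<close> restricted to the orbit is a competitor on the half-line.
  Hence both infima equal the least \<open>R\<close> satisfying the condition.

  Haar measure must be shown to exist before it can be used. By Kronecker's theorem the orbit
  closure is the image of a torus under a homomorphism (\<open>orbit_closure_eq_torus\<close>), so a
  convolution of uniform measures on circles does the job (\<open>torus_invariant_measure\<close>).
\<close>

section \<open>The orbit closure as the image of a torus\<close>

text \<open>
  The frequencies need not be independent over \<open>\<int>\<close>, but they are integer combinations of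
  finitely many independent reals. A new real that is rationally dependent on the family
  built so far, say \<open>k a = \<Sum> c\<^sub>i \<theta>\<^sub>i\<close>, is absorbed by dividing the whole family by \<open>k\<close>; otherwise
  it is appended.
\<close>

lemma integer_combinations_of_independent_reals:
  fixes A :: "real set"
  assumes "finite A"
  shows "\<exists>(\<theta>::nat \<Rightarrow> real) n (N::real \<Rightarrow> nat \<Rightarrow> int).
    (\<forall>c::nat \<Rightarrow> int. (\<Sum>i<n. of_int (c i) * \<theta> i) = 0 \<longrightarrow> (\<forall>i<n. c i = 0)) \<and>
    (\<forall>a\<in>A. a = (\<Sum>i<n. of_int (N a i) * \<theta> i))"
  using assms
proof (induction A rule: finite_induct)
  case empty
  show ?case by (rule exI[of _ "\<lambda>_. 0"], rule exI[of _ 0]) auto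
next
  case (insert a A)
  then obtain \<theta> n N where
    ind: "\<And>c::nat \<Rightarrow> int. (\<Sum>i<n. of_int (c i) * \<theta> i) = 0 \<Longrightarrow> \<forall>i<n. c i = 0"
    and N: "\<And>x. x \<in> A \<Longrightarrow> x = (\<Sum>i<n. of_int (N x i) * (\<theta> i::real))"
    by metis
  show ?case
  proof (cases "\<exists>k c. k \<noteq> (0::int) \<and> of_int k * a = (\<Sum>i<n. of_int (c i) * \<theta> i)")
    case True
    then obtain k c where k: "k \<noteq> (0::int)" "of_int k * a = (\<Sum>i<n. of_int (c i) * \<theta> i)" by blast
    define \<theta>' where "\<theta>' i = \<theta> i / of_int k" for i
    define N' where "N' x i = (if x = a then c i else k * N x i)" for x i
    have 1: "\<forall>i<n. d i = 0" if "(\<Sum>i<n. of_int (d i) * \<theta>' i) = 0" for d :: "nat \<Rightarrow> int"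
    proof (rule ind)
      have "(\<Sum>i<n. of_int (d i) * \<theta>' i) = (\<Sum>i<n. of_int (d i) * \<theta> i) / of_int k"
        by (simp add: \<theta>'_def sum_divide_distrib)
      then show "(\<Sum>i<n. of_int (d i) * \<theta> i) = 0" using that k(1) by simp
    qed
    have 2: "x = (\<Sum>i<n. of_int (N' x i) * \<theta>' i)" if "x \<in> insert a A" for x
    proof (cases "x = a")
      case True
      have "(\<Sum>i<n. of_int (N' x i) * \<theta>' i) = (\<Sum>i<n. of_int (c i) * \<theta> i) / of_int k"
        using True by (simp add: N'_def \<theta>'_def sum_divide_distrib)
      with k have "(\<Sum>i<n. of_int (N' x i) * \<theta>' i) = a" by (metis nonzero_mult_div_cancel_left of_int_eq_0_iff)
      with True show ?thesis by simp
    next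
      case False
      have "(\<Sum>i<n. of_int (N' x i) * \<theta>' i) = (\<Sum>i<n. of_int (N x i) * \<theta> i)"
        using False k(1) by (intro sum.cong) (auto simp: N'_def \<theta>'_def)
      with N[of x] that False show ?thesis by simp
    qed
    show ?thesis using 1 2 by (intro exI[of _ "\<theta>'"] exI[of _ n] exI[of _ N'] conjI ballI) blast+
  next
    case False
    define \<theta>' where "\<theta>' = \<theta>(n := a)"
    define N' where "N' x i = (if x = a then (if i = n then 1 else 0) else if i = n then 0 else N x i)"
      for x i
    have [simp]: "(\<Sum>i<n. f i * \<theta>' i) = (\<Sum>i<n. f i * \<theta> i)" for f
      by (intro sum.cong) (auto simp: \<theta>'_def)
    have 1: "\<forall>i<Suc n. d i = 0" if d: "(\<Sum>i<Suc n. of_int (d i) * \<theta>' i) = 0" for d :: "nat \<Rightarrow> int"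
    proof -
      have eq: "(\<Sum>i<n. of_int (d i) * \<theta> i) + of_int (d n) * a = 0"
        using d by (simp add: \<theta>'_def[THEN fun_cong, of n])
      then have *: "of_int (d n) * a = (\<Sum>i<n. of_int (- d i) * \<theta> i)"
        by (simp add: sum_negf)
      have "k = 0" if "of_int k * a = (\<Sum>i<n. of_int (c i) * \<theta> i)" for k and c :: "nat \<Rightarrow> int"
        using False that by auto
      from this[OF *] have "d n = 0" .
      then show ?thesis using eq ind[of d] by (auto simp: less_Suc_eq)
    qed
    have 2: "x = (\<Sum>i<Suc n. of_int (N' x i) * \<theta>' i)" if "x \<in> insert a A" for x
    proof (cases "x = a")
      case True
      then show ?thesis by (simp add: N'_def \<theta>'_def[THEN fun_cong, of n])
    next
      case False
      have "(\<Sum>i<n. of_int (N' x i) * \<theta> i) = (\<Sum>i<n. of_int (N x i) * \<theta> i)"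
        using False by (intro sum.cong) (auto simp: N'_def)
      with N[of x] that False show ?thesis by (simp add: N'_def)
    qed
    show ?thesis using 1 2 by (intro exI[of _ "\<theta>'"] exI[of _ "Suc n"] exI[of _ N'] conjI ballI) blast+
  qed
qed

text \<open>
  Kronecker's theorem in terms of independence of an indexed family; such a family is
  automatically injective, because equal members would be dependent.
\<close>

lemma Kronecker_simultaneous_approximation:
  fixes \<theta> :: "nat \<Rightarrow> real" and \<epsilon> :: real
  assumes ind: "\<And>c::nat \<Rightarrow> int. (\<Sum>i<n. of_int (c i) * \<theta> i) = 0 \<Longrightarrow> \<forall>i<n. c i = 0"
    and "\<epsilon> > 0"
  obtains t h where "\<And>i. i < n \<Longrightarrow> \<bar>t * \<theta> i - of_int (h i) - \<alpha> i\<bar> < \<epsilon>"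
proof -
  interpret Z: Modules.module "(\<lambda>r. (*) (real_of_int r))"
    by (simp add: Modules.module.intro distrib_left mult.commute)
  have inj: "inj_on \<theta> {..<n}"
  proof (rule inj_onI, rule ccontr)
    fix i j assume ij: "i \<in> {..<n}" "j \<in> {..<n}" "\<theta> i = \<theta> j" "i \<noteq> j"
    define c where "c k = (if k = i then 1 else 0) - (if k = j then 1 else (0::int))" for k
    have "(\<Sum>k<n. of_int (c k) * \<theta> k) =
      (\<Sum>k<n. if k = i then \<theta> k else 0) - (\<Sum>k<n. if k = j then \<theta> k else 0)"
      unfolding sum_subtractf[symmetric] by (intro sum.cong) (auto simp: c_def)
    also have "\<dots> = 0" using ij by (simp add: sum.delta)
    finally have "c i = 0" using ind[of c] ij by blast
    then show False using ij by (simp add: c_def)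
  qed
  have "\<not> Z.dependent (\<theta> ` {..<n})"
  proof
    assume "Z.dependent (\<theta> ` {..<n})"
    then obtain u v where v: "v \<in> \<theta> ` {..<n}" "u v \<noteq> 0"
      and s: "(\<Sum>v\<in>\<theta> ` {..<n}. of_int (u v) * v) = 0"
      by (subst (asm) Z.dependent_finite) auto
    have "(\<Sum>i<n. of_int (u (\<theta> i)) * \<theta> i) = 0"
      using s by (subst (asm) sum.reindex[OF inj]) simp
    then show False using ind[of "\<lambda>i. u (\<theta> i)"] v by auto
  qed
  then show thesis
    using Kronecker_thm_1[OF _ inj \<open>\<epsilon> > 0\<close>, where \<alpha>=\<alpha>] that by blast
qed

text \<open>
  The image of the angle vector \<open>t\<close> (in full turns) under the homomorphism from the standard
  \<open>n\<close>-torus given by the exponent matrix \<open>N\<close>.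
\<close>

definition torus_point :: "('m \<Rightarrow> nat \<Rightarrow> int) \<Rightarrow> nat \<Rightarrow> (nat \<Rightarrow> real) \<Rightarrow> complex ^ 'm" where
  "torus_point N n t = (\<chi> j. exp (\<i> * complex_of_real (2 * pi * (\<Sum>k<n. of_int (N j k) * t k))))"

definition circle_point :: "('m \<Rightarrow> int) \<Rightarrow> real \<Rightarrow> complex ^ 'm" where
  "circle_point v s = (\<chi> j. exp (\<i> * complex_of_real (2 * pi * of_int (v j) * s)))"

lemma torus_point_0 [simp]: "torus_point N 0 t = 1"
  by (simp add: torus_point_def vec_eq_iff)

lemma torus_point_Suc:
  "torus_point N (Suc n) t = circle_point (\<lambda>j. N j n) (t n) * torus_point N n t"
  by (simp add: torus_point_def circle_point_def vec_eq_iff algebra_simps flip: exp_add)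

lemma torus_point_add: "torus_point N n s * torus_point N n t = torus_point N n (\<lambda>k. s k + t k)"
  by (simp add: torus_point_def vec_eq_iff algebra_simps sum.distrib flip: exp_add)

lemma torus_point_cong: "(\<And>k. k < n \<Longrightarrow> s k = t k) \<Longrightarrow> torus_point N n s = torus_point N n t"
  by (simp add: torus_point_def)

lemma circle_point_add: "circle_point v (s + t) = circle_point v s * circle_point v t"
  by (simp add: circle_point_def vec_eq_iff algebra_simps flip: exp_add)

lemma circle_point_periodic: "circle_point v (s + of_int k) = circle_point v s"
proof -
  have "circle_point v (of_int k) = 1"
  proof -
    have "exp (\<i> * complex_of_real (2 * pi * of_int (v j) * of_int k)) = 1" for j
      using exp_integer_2pi[of "of_int (v j * k)"] by (simp add: algebra_simps)
    then show ?thesis by (simp add: circle_point_def vec_eq_iff)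
  qed
  then show ?thesis by (simp add: circle_point_add)
qed

lemma continuous_on_vec_times [continuous_intros]:
  fixes f g :: "'b::topological_space \<Rightarrow> complex ^ 'm"
  assumes "continuous_on S f" "continuous_on S g"
  shows "continuous_on S (\<lambda>x. f x * g x)"
  unfolding times_vec_def using assms by (intro continuous_intros) 

lemma borel_measurable_vec_times [measurable]:
  fixes f g :: "'b \<Rightarrow> complex ^ 'm"
  assumes "f \<in> borel_measurable M" "g \<in> borel_measurable M"
  shows "(\<lambda>x. f x * g x) \<in> borel_measurable M"
  by (rule borel_measurable_continuous_Pair[OF assms]) 
    (intro continuous_intros)

lemma continuous_circle_point: "continuous_on S (circle_point v)"
  unfolding circle_point_def by (intro continuous_intros)

lemma borel_measurable_circle_point [measurable]: "circle_point v \<in> borel_measurable borel"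
  by (intro borel_measurable_continuous_onI continuous_circle_point)

text \<open>
  By periodicity each angle may be restricted to \<open>[0,1]\<close>, so the torus is built from \<open>n\<close>
  compact circles, one continuous multiplication at a time.
\<close>

lemma compact_range_torus_point: "compact (range (torus_point N n))"
proof (induction n)
  case 0
  then show ?case by (simp add: image_def)
next
  case (Suc n)
  have "range (torus_point N (Suc n)) =
    (\<lambda>(s, z). circle_point (\<lambda>j. N j n) s * z) ` ({0..1} \<times> range (torus_point N n))" (is "?L = ?R")
  proof
    show "?L \<subseteq> ?R"
    proof
      fix z assume "z \<in> ?L"
      then obtain t where t: "z = torus_point N (Suc n) t" by blast
      have "circle_point (\<lambda>j. N j n) (t n) = circle_point (\<lambda>j. N j n) (frac (t n))"
        using circle_point_periodic[of "\<lambda>j. N j n" "frac (t n)" "\<lfloor>t n\<rfloor>"] by (simp add: frac_def)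
      moreover have "frac (t n) \<in> {0..1}" by (simp add: frac_lt_1 less_imp_le)
      ultimately show "z \<in> ?R" unfolding t torus_point_Suc by force
    qed
    show "?R \<subseteq> ?L"
    proof clarify
      fix s t
      have "circle_point (\<lambda>j. N j n) s * torus_point N n t = torus_point N (Suc n) (t(n := s))"
        unfolding torus_point_Suc by (simp cong: torus_point_cong)
      then show "circle_point (\<lambda>j. N j n) s * torus_point N n t \<in> range (torus_point N (Suc n))"
        by simp
    qed
  qed
  moreover have "compact \<dots>"
    unfolding case_prod_unfold
    by (intro compact_continuous_image compact_Times Suc compact_Icc continuous_intros 
         continuous_on_compose2[OF continuous_circle_point[of UNIV]]) auto
  ultimately show ?case by simp
qed

lemma nn_integral_periodic_shift:
  fixes g :: "real \<Rightarrow> ennreal"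
  assumes [measurable]: "g \<in> borel_measurable borel" and per: "\<And>x k. g (x + of_int k) = g x"
  shows "(\<integral>\<^sup>+x. g (x + s) * indicator {0..<1} x \<partial>lborel) = (\<integral>\<^sup>+x. g x * indicator {0..<1} x \<partial>lborel)"
proof -
  define r where "r = frac s"
  have r: "0 \<le> r" "r < 1" by (auto simp: r_def frac_lt_1)
  have g: "g (x + s) = g (x + r)" for x
    using per[of "x + r" "\<lfloor>s\<rfloor>"] by (simp add: r_def frac_def)
  have "(\<integral>\<^sup>+x. g (x + s) * indicator {0..<1} x \<partial>lborel)
      = (\<integral>\<^sup>+x. g x * indicator {r..<1+r} x \<partial>lborel)"
    by (subst (2) nn_integral_real_affine[where c=1 and t=r])
       (auto simp: g add.commute intro!: nn_integral_cong split: split_indicator)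
  also have "\<dots> = (\<integral>\<^sup>+x. g x * indicator {r..<1} x \<partial>lborel) + (\<integral>\<^sup>+x. g x * indicator {1..<1+r} x \<partial>lborel)"
    using r by (subst nn_integral_add[symmetric]) (auto intro!: nn_integral_cong split: split_indicator)
  also have "(\<integral>\<^sup>+x. g x * indicator {1..<1+r} x \<partial>lborel) = (\<integral>\<^sup>+x. g x * indicator {0..<r} x \<partial>lborel)"
    using per[of _ 1]
    by (subst nn_integral_real_affine[where c=1 and t=1])
       (auto simp: add.commute intro!: nn_integral_cong split: split_indicator)
  also have "(\<integral>\<^sup>+x. g x * indicator {r..<1} x \<partial>lborel) + \<dots> = (\<integral>\<^sup>+x. g x * indicator {0..<1} x \<partial>lborel)"
    using r by (subst nn_integral_add[symmetric]) (auto intro!: nn_integral_cong split: split_indicator)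
  finally show ?thesis .
qed

text \<open>
  Haar measure on the image torus is the multiplicative convolution of the uniform
  distributions on \<open>n\<close> circles. Each new circle factor makes the measure invariant under that
  circle, because a shift of the angle does not change the integral of a periodic function
  over a period, and convolution preserves the invariance that is already there, since
  multiplication is commutative.
\<close>

lemma torus_invariant_measure:
  "\<exists>M. sets M = sets (borel :: (complex ^ 'm) measure) \<and> prob_space M \<and>
     (AE z in M. z \<in> range (torus_point N n)) \<and>
     (\<forall>w\<in>range (torus_point N n). distr M M (\<lambda>z. w * z) = M)"
proof (induction n)
  case 0
  have "range (torus_point N 0) = {1}" by auto
  then show ?case
    by (intro exI[of _ "return borel 1"]) (auto simp: prob_space_return AE_return distr_id2)
next
  case (Suc n)
  let ?H = "range (torus_point N n)" and ?H' = "range (torus_point N (Suc n))"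
  obtain M where sets_M[measurable_cong]: "sets M = sets (borel :: (complex ^ 'm) measure)"
    and pM: "prob_space M" and aeM: "AE z in M. z \<in> ?H"
    and invM: "\<And>w. w \<in> ?H \<Longrightarrow> distr M M (\<lambda>z. w * z) = M"
    using Suc by blast
  interpret M: prob_space M by fact
  let ?e = "circle_point (\<lambda>j. N j n)"
  define U where "U = uniform_measure lborel {0..<1::real}"
  have [measurable_cong]: "sets U = sets borel" by (simp add: U_def)
  interpret U: prob_space U unfolding U_def by (rule prob_space_uniform_measure) auto
  interpret UM: pair_prob_space U M ..
  have nnU: "(\<integral>\<^sup>+x. f x \<partial>U) = (\<integral>\<^sup>+x. f x * indicator {0..<1} x \<partial>lborel)" 
    if [measurable]: "f \<in> borel_measurable borel" for f
    unfolding U_def by (subst nn_integral_uniform_measure) (auto simp: divide_ennreal_def)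
  define M' where "M' = distr (U \<Otimes>\<^sub>M M) borel (\<lambda>(s, z). ?e s * z)"
  have [measurable]: "(\<lambda>(s, z). ?e s * z) \<in> borel_measurable (U \<Otimes>\<^sub>M M)" by measurable
  have "sets M' = sets borel" by (simp add: M'_def)
  moreover have "prob_space M'" unfolding M'_def by (rule UM.prob_space_distr) measurable
  moreover have "AE z in M'. z \<in> ?H'"
  proof -
    have [measurable]: "?H' \<in> sets borel" "?H \<in> sets borel"
      by (intro borel_compact compact_range_torus_point)+
    have sub: "?e s * z \<in> ?H'" if "z \<in> ?H" for s z
    proof -
      from that obtain t where "z = torus_point N n t" by blast
      then have "?e s * z = torus_point N (Suc n) (t(n := s))"
        unfolding torus_point_Suc by (simp cong: torus_point_cong)
      then show ?thesis by simp
    qed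
    have "AE p in U \<Otimes>\<^sub>M M. ?e (fst p) * snd p \<in> ?H'"
    proof (rule UM.AE_pair_measure)
      show "{x \<in> space (U \<Otimes>\<^sub>M M). ?e (fst x) * snd x \<in> ?H'} \<in> sets (U \<Otimes>\<^sub>M M)" by measurable
      show "AE x in U. AE y in M. ?e (fst (x, y)) * snd (x, y) \<in> ?H'"
        using aeM sub by (auto elim!: eventually_mono)
    qed
    then show ?thesis unfolding M'_def by (subst AE_distr_iff) (auto simp: case_prod_unfold)
  qed
  moreover have "distr M' M' (\<lambda>z. w * z) = M'" if w: "w \<in> ?H'" for w
  proof (rule measure_eqI)
    obtain s w' where w': "w' \<in> ?H" "w = ?e s * w'"
      using w by (auto simp: torus_point_Suc)
    fix A assume "A \<in> sets (distr M' M' (\<lambda>z. w * z))"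
    then have A[measurable]: "A \<in> sets borel" by (simp add: M'_def)
    have [measurable_cong]: "sets M' = sets borel" by (simp add: M'_def)
    define g where "g x = (\<integral>\<^sup>+z. indicator A (?e x * z) \<partial>M)" for x
    have [measurable]: "g \<in> borel_measurable borel" unfolding g_def by measurable
    have em: "emeasure M' B = (\<integral>\<^sup>+x. \<integral>\<^sup>+z. indicator B (?e x * z) \<partial>M \<partial>U)" if [measurable]: "B \<in> sets borel" for B
      unfolding M'_def
      by (simp add: nn_integral_indicator[symmetric] nn_integral_distr M.nn_integral_fst[symmetric] del: nn_integral_indicator)
    \<comment> \<open>The torus part \<open>w'\<close> of \<open>w\<close> is absorbed by \<open>M\<close>, the circle part becomes a shift of the angle.\<close>
    have "emeasure (distr M' M' (\<lambda>z. w * z)) A = (\<integral>\<^sup>+z. indicator A (w * z) \<partial>M')"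
      by (simp add: nn_integral_indicator[symmetric] nn_integral_distr del: nn_integral_indicator)
    also have "\<dots> = (\<integral>\<^sup>+x. \<integral>\<^sup>+z. indicator A (w * (?e x * z)) \<partial>M \<partial>U)"
      unfolding M'_def by (simp add: nn_integral_distr M.nn_integral_fst[symmetric])
    also have "\<dots> = (\<integral>\<^sup>+x. g (x + s) \<partial>U)"
    proof (rule nn_integral_cong)
      fix x
      have "(\<integral>\<^sup>+z. indicator A (w * (?e x * z)) \<partial>M) = (\<integral>\<^sup>+z. indicator A (?e (x + s) * (w' * z)) \<partial>M)"
        by (simp add: w' circle_point_add mult_ac)
      also have "\<dots> = (\<integral>\<^sup>+z. indicator A (?e (x + s) * z) \<partial>distr M M (\<lambda>z. w' * z))"
        by (subst nn_integral_distr) auto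
      also have "\<dots> = g (x + s)" using invM[OF w'(1)] by (simp add: g_def)
      finally show "(\<integral>\<^sup>+z. indicator A (w * (?e x * z)) \<partial>M) = g (x + s)" .
    qed
    also have "\<dots> = (\<integral>\<^sup>+x. g (x + s) * indicator {0..<1} x \<partial>lborel)" by (rule nnU) measurable
    also have "\<dots> = (\<integral>\<^sup>+x. g x * indicator {0..<1} x \<partial>lborel)"
      by (rule nn_integral_periodic_shift) (auto simp: g_def circle_point_periodic)
    also have "\<dots> = emeasure M' A" by (simp add: em nnU g_def[symmetric])
    finally show "emeasure (distr M' M' (\<lambda>z. w * z)) A = emeasure M' A" .
  qed simp
  ultimately show ?case by blast
qed

text \<open>
  With \<open>\<gamma>\<^sub>j = \<Sum> N\<^sub>j\<^sub>k \<theta>\<^sub>k\<close>, the orbit lies in the image torus, which is compact; by Kronecker's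
  theorem the line in direction \<open>\<theta>\<close> is dense in the standard torus, hence its image, the orbit,
  is dense in the image torus. This makes the orbit closure a compact group carrying the
  measure constructed above.
\<close>

lemma orbit_closure_eq_torus:
  fixes \<gamma> :: "real ^ 'm"
  obtains N n where "orbit_closure \<gamma> = range (torus_point N n)"
proof -
  obtain \<theta> n and N :: "real \<Rightarrow> nat \<Rightarrow> int" where
    ind: "\<And>c::nat \<Rightarrow> int. (\<Sum>i<n. of_int (c i) * \<theta> i) = 0 \<Longrightarrow> \<forall>i<n. c i = 0"
    and N: "\<And>j. \<gamma> $ j = (\<Sum>i<n. of_int (N (\<gamma> $ j) i) * (\<theta> i::real))"
    using integer_combinations_of_independent_reals[of "range (\<lambda>j. \<gamma> $ j)"] by auto
  define N' where "N' j = N (\<gamma> $ j)" for j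
  have flow_eq: "flow \<gamma> y = torus_point N' n (\<lambda>k. \<theta> k * y / (2 * pi))" for y
  proof -
    have "\<gamma> $ j * y = 2 * pi * (\<Sum>k<n. of_int (N' j k) * (\<theta> k * y / (2 * pi)))" for j
      by (subst N) (simp add: N'_def sum_distrib_left sum_distrib_right mult_ac)
    then show ?thesis by (simp add: flow_def torus_point_def)
  qed
  have "orbit_closure \<gamma> = range (torus_point N' n)"
    unfolding orbit_closure_def
  proof
    show "closure (range (flow \<gamma>)) \<subseteq> range (torus_point N' n)"
      by (rule closure_minimal) (auto simp: flow_eq compact_range_torus_point compact_imp_closed)
    show "range (torus_point N' n) \<subseteq> closure (range (flow \<gamma>))"
    proof clarify
      fix \<alpha> :: "nat \<Rightarrow> real"
      show "torus_point N' n \<alpha> \<in> closure (range (flow \<gamma>))"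
      proof (rule closure_approachable[THEN iffD2], intro allI impI)
        fix e :: real assume "e > 0"
        define K where "K = (\<Sum>j\<in>(UNIV::'m set). \<Sum>k<n. 2 * pi * \<bar>of_int (N' j k)\<bar>) + 1"
        have K: "K > 0" unfolding K_def by (intro add_nonneg_pos sum_nonneg) auto
        then have "e / K > 0" using \<open>e > 0\<close> by simp
        then obtain t h where th: "\<And>i. i < n \<Longrightarrow> \<bar>t * \<theta> i - of_int (h i) - \<alpha> i\<bar> < e / K"
          using Kronecker_simultaneous_approximation[OF ind, where \<alpha>=\<alpha>] by metis
        let ?y = "2 * pi * t"
        have comp: "cmod (flow \<gamma> ?y $ j - torus_point N' n \<alpha> $ j)
            \<le> (\<Sum>k<n. 2 * pi * \<bar>of_int (N' j k)\<bar>) * (e / K)" for j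
        proof -
          define H where "H = (\<Sum>k<n. N' j k * h k)"
          define x where "x = 2 * pi * (\<Sum>k<n. of_int (N' j k) * (t * \<theta> k - of_int (h k)))"
          define x' where "x' = 2 * pi * (\<Sum>k<n. of_int (N' j k) * \<alpha> k)"
          \<comment> \<open>The integer parts \<open>h k\<close> contribute only whole turns \<open>H\<close>.\<close>
          have "flow \<gamma> ?y $ j = exp (\<i> * complex_of_real (x + 2 * pi * of_int H))"
            unfolding flow_eq torus_point_def x_def H_def
            by (simp add: algebra_simps sum_subtractf sum_distrib_left)
          also have "\<dots> = exp (\<i> * complex_of_real x)"
            using exp_integer_2pi[of "of_int H"] by (simp add: ring_distribs exp_add mult_ac)
          finally have "cmod (flow \<gamma> ?y $ j - torus_point N' n \<alpha> $ j) = cmod (exp (\<i> * x) - exp (\<i> * x'))"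
            by (simp add: torus_point_def x'_def)
          also have "\<dots> \<le> \<bar>x - x'\<bar>"
          proof -
            have "cmod (exp (\<i> * x) - exp (\<i> * x')) = cmod (exp (\<i> * x') * (exp (\<i> * (x - x')) - 1))"
              by (simp add: algebra_simps flip: exp_add)
            also have "\<dots> = cmod (exp (\<i> * (x - x')) - 1)" by (simp add: norm_mult)
            also have "\<dots> \<le> \<bar>x - x'\<bar>" 
              using iexp_approx1[of "x - x'" 0] by simp
            finally show ?thesis .
          qed
          also have "x - x' = (\<Sum>k<n. 2 * pi * of_int (N' j k) * (t * \<theta> k - of_int (h k) - \<alpha> k))"
            by (simp add: x_def x'_def sum_distrib_left algebra_simps flip: sum_subtractf)
          also have "\<bar>\<dots>\<bar> \<le> (\<Sum>k<n. 2 * pi * \<bar>of_int (N' j k)\<bar> * (e / K))"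
          proof (intro order.trans[OF sum_abs] sum_mono)
            fix k assume "k \<in> {..<n}"
            then show "\<bar>2 * pi * of_int (N' j k) * (t * \<theta> k - of_int (h k) - \<alpha> k)\<bar>
                \<le> 2 * pi * \<bar>of_int (N' j k)\<bar> * (e / K)"
              using mult_left_mono[OF less_imp_le[OF th[of k]], of "2 * pi * \<bar>of_int (N' j k)\<bar>"]
              by (simp add: abs_mult)
          qed
          finally show ?thesis by (simp only: sum_distrib_right)
        qed
        have "dist (flow \<gamma> ?y) (torus_point N' n \<alpha>) \<le> (\<Sum>j\<in>UNIV. cmod (flow \<gamma> ?y $ j - torus_point N' n \<alpha> $ j))"
          unfolding dist_norm norm_vec_def by (rule order.trans[OF L2_set_le_sum]) simp_all
        also have "\<dots> \<le> (\<Sum>j\<in>(UNIV::'m set). (\<Sum>k<n. 2 * pi * \<bar>of_int (N' j k)\<bar>) * (e / K))"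
          by (intro sum_mono comp)
        also have "\<dots> = (K - 1) * (e / K)"
          by (simp only: K_def sum_distrib_right add_diff_cancel_right')
        also have "\<dots> < e" using K \<open>e > 0\<close> by (simp add: field_simps)
        finally show "\<exists>y\<in>range (flow \<gamma>). dist y (torus_point N' n \<alpha>) < e" by blast
      qed
    qed
  qed
  then show thesis by (rule that)
qed

lemma one_in_orbit_closure: "1 \<in> orbit_closure \<gamma>"
proof -
  have "flow \<gamma> 0 = 1" by (simp add: flow_def vec_eq_iff)
  then show ?thesis unfolding orbit_closure_def by (metis closure_subset rangeI subsetD)
qed

lemma flow_in_orbit_closure: "flow \<gamma> y \<in> orbit_closure \<gamma>"
  unfolding orbit_closure_def using closure_subset by fastforce

lemma compact_orbit_closure: "compact (orbit_closure \<gamma>)"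
  using orbit_closure_eq_torus compact_range_torus_point by metis

lemma orbit_closure_times:
  assumes "w \<in> orbit_closure \<gamma>" "z \<in> orbit_closure \<gamma>"
  shows "w * z \<in> orbit_closure \<gamma>"
proof -
  obtain N n where "orbit_closure \<gamma> = range (torus_point N n)" by (rule orbit_closure_eq_torus)
  with assms show ?thesis by (auto simp: torus_point_add)
qed

lemma orbit_closure_times_iff:
  assumes "w \<in> orbit_closure \<gamma>"
  shows "w * z \<in> orbit_closure \<gamma> \<longleftrightarrow> z \<in> orbit_closure \<gamma>"
proof
  assume wz: "w * z \<in> orbit_closure \<gamma>"
  obtain N n where G: "orbit_closure \<gamma> = range (torus_point N n)" by (rule orbit_closure_eq_torus)
  with assms obtain t where t: "w = torus_point N n t" by blast
  have "torus_point N n (\<lambda>k. - t k) * w = 1"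
    by (simp add: t torus_point_add) (simp add: torus_point_def vec_eq_iff)
  then have "z = torus_point N n (\<lambda>k. - t k) * (w * z)" by (metis mult.assoc mult_1)
  then show "z \<in> orbit_closure \<gamma>" using wz G orbit_closure_times by (metis rangeI)
qed (use assms orbit_closure_times in blast)

lemma norm_orbit_closure_nth:
  assumes "z \<in> orbit_closure \<gamma>"
  shows "cmod (z $ j) = 1"
proof -
  obtain N n where "orbit_closure \<gamma> = range (torus_point N n)" by (rule orbit_closure_eq_torus)
  with assms show ?thesis by (auto simp: torus_point_def)
qed

lemma borel_orbit_closure [measurable]: "orbit_closure \<gamma> \<in> sets borel"
  by (simp add: orbit_closure_def)

text \<open>
  The invariant measure on the ambient space is concentrated on the orbit closure; its
  restriction there is the witness that justifies the choice in \<^const>\<open>haar\<close>.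
\<close>

proposition haar_probability_haar:
  fixes \<gamma> :: "real ^ 'm"
  shows "haar_probability (orbit_closure \<gamma>) (haar \<gamma>)"
proof -
  let ?G = "orbit_closure \<gamma>"
  obtain N n where G: "?G = range (torus_point N n)" by (rule orbit_closure_eq_torus)
  obtain M where sets_M[measurable_cong]: "sets M = sets (borel :: (complex ^ 'm) measure)"
    and pM: "prob_space M" and aeM: "AE z in M. z \<in> ?G"
    and invM: "\<And>w. w \<in> ?G \<Longrightarrow> distr M M (\<lambda>z. w * z) = M"
    using torus_invariant_measure[of N n] unfolding G by blast
  interpret prob_space M by fact
  have [simp]: "space M = UNIV" using sets_eq_imp_space_eq[OF sets_M] by simp
  define R where "R = restrict_space M ?G"
  have sp: "space R = ?G" and se: "sets R = sets (restrict_space borel ?G)"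
    unfolding R_def by (auto simp: space_restrict_space intro!: sets_restrict_space_cong sets_M)
  have em: "emeasure R A = emeasure M A" if "A \<in> sets R" for A
    using that unfolding R_def
    by (subst emeasure_restrict_space) (auto simp: sets_M sets_restrict_space)
  have meas: "(\<lambda>z. w * z) \<in> measurable R R" if "w \<in> ?G" for w
  proof -
    have "(\<lambda>z. w * z) \<in> measurable (restrict_space borel ?G) (restrict_space borel ?G)"
      using that orbit_closure_times[of w \<gamma>]
      by (intro measurable_restrict_space3) auto
    then show ?thesis using se by (simp cong: measurable_cong_sets)
  qed
  have "haar_probability ?G R"
    unfolding haar_probability_def
  proof (intro conjI ballI sp se)
    show "prob_space R"
    proof (rule prob_spaceI)
      have "emeasure R ?G = emeasure M ?G"
        by (rule em) (auto simp: se sets_restrict_space)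
      then show "emeasure R (space R) = 1"
        using aeM by (simp add: sp emeasure_eq_1_AE)
    qed
    fix w assume w: "w \<in> ?G"
    show "distr R R (\<lambda>z. w * z) = R"
    proof (rule measure_eqI)
      fix A assume "A \<in> sets (distr R R (\<lambda>z. w * z))"
      then have AR: "A \<in> sets R" by simp
      then have A: "A \<subseteq> ?G" and [measurable]: "A \<in> sets borel"
        by (auto simp: se sets_restrict_space)
      have "emeasure (distr R R (\<lambda>z. w * z)) A = emeasure R ((\<lambda>z. w * z) -` A \<inter> ?G)"
        using AR by (simp add: emeasure_distr meas w sp)
      also have "(\<lambda>z. w * z) -` A \<inter> ?G = (\<lambda>z. w * z) -` A"
        using A orbit_closure_times_iff[OF w] by blast
      also have "emeasure R \<dots> = emeasure M ((\<lambda>z. w * z) -` A)"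
        using calculation measurable_sets[OF meas[OF w] AR] sp \<open>(\<lambda>z. w * z) -` A \<inter> ?G = (\<lambda>z. w * z) -` A\<close>
        by (intro em) simp
      also have "\<dots> = emeasure (distr M M (\<lambda>z. w * z)) A"
        by (subst emeasure_distr) auto
      also have "\<dots> = emeasure R A" using em[OF AR] invM[OF w] by simp
      finally show "emeasure (distr R R (\<lambda>z. w * z)) A = emeasure R A" .
    qed simp
  qed
  then show ?thesis unfolding haar_def by (rule someI)
qed

section \<open>Integration with respect to Haar measure\<close>

lemma
  fixes \<gamma> :: "real ^ 'm"
  shows space_haar: "space (haar \<gamma>) = orbit_closure \<gamma>"
    and sets_haar: "sets (haar \<gamma>) = sets (restrict_space borel (orbit_closure \<gamma>))"
    and prob_space_haar: "prob_space (haar \<gamma>)"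
    and haar_invariant: "w \<in> orbit_closure \<gamma> \<Longrightarrow> distr (haar \<gamma>) (haar \<gamma>) (\<lambda>z. w * z) = haar \<gamma>"
  using haar_probability_haar[of \<gamma>] unfolding haar_probability_def by auto

lemma borel_measurable_haar:
  fixes h :: "complex ^ 'm \<Rightarrow> 'b::topological_space"
  assumes "h \<in> borel_measurable borel"
  shows "h \<in> borel_measurable (haar \<gamma>)"
  using measurable_restrict_space1[OF assms] by (simp cong: measurable_cong_sets add: sets_haar)

lemma continuous_bounded_on_orbit_closure:
  fixes h :: "complex ^ 'm \<Rightarrow> 'b::real_normed_vector"
  assumes "continuous_on UNIV h"
  obtains B where "B \<ge> 0" "\<And>z. z \<in> orbit_closure \<gamma> \<Longrightarrow> norm (h z) \<le> B"
proof -
  have "compact (h ` orbit_closure \<gamma>)"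
    using assms continuous_on_subset compact_orbit_closure by (blast intro: compact_continuous_image)
  then obtain B where "\<forall>x\<in>h ` orbit_closure \<gamma>. norm x \<le> B"
    using compact_imp_bounded bounded_iff by blast
  with one_in_orbit_closure have "\<And>z. z \<in> orbit_closure \<gamma> \<Longrightarrow> norm (h z) \<le> \<bar>B\<bar>" by fastforce
  then show thesis by (intro that[of "\<bar>B\<bar>"]) auto
qed

lemma integrable_haar:
  fixes h :: "complex ^ 'm \<Rightarrow> 'b::{banach, second_countable_topology}"
  assumes "continuous_on UNIV h"
  shows "integrable (haar \<gamma>) h"
proof -
  interpret prob_space "haar \<gamma>" by (rule prob_space_haar)
  obtain B where "\<And>z. z \<in> orbit_closure \<gamma> \<Longrightarrow> norm (h z) \<le> B"
    using continuous_bounded_on_orbit_closure[OF assms] by blast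
  then show ?thesis
    using assms by (intro integrable_const_bound[where B=B] borel_measurable_haar
        borel_measurable_continuous_onI) (auto simp: space_haar)
qed

lemma integral_haar_translate:
  fixes h :: "complex ^ 'm \<Rightarrow> 'b::{banach, second_countable_topology}"
  assumes "continuous_on UNIV h" "w \<in> orbit_closure \<gamma>"
  shows "(\<integral>z. h (w * z) \<partial>haar \<gamma>) = (\<integral>z. h z \<partial>haar \<gamma>)"
proof -
  have "(\<lambda>z. w * z) \<in> measurable (restrict_space borel (orbit_closure \<gamma>)) (restrict_space borel (orbit_closure \<gamma>))"
    using orbit_closure_times[OF assms(2)] by (intro measurable_restrict_space3) auto
  then have "(\<lambda>z. w * z) \<in> measurable (haar \<gamma>) (haar \<gamma>)"
    by (simp cong: measurable_cong_sets add: sets_haar)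
  then have "(\<integral>z. h z \<partial>distr (haar \<gamma>) (haar \<gamma>) (\<lambda>z. w * z)) = (\<integral>z. h (w * z) \<partial>haar \<gamma>)"
    using assms(1) by (intro integral_distr borel_measurable_haar borel_measurable_continuous_onI)
  then show ?thesis by (simp add: haar_invariant assms(2))
qed

lemma continuous_flow: "continuous_on S (flow \<gamma>)"
  unfolding flow_def by (intro continuous_intros)

lemma flow_add: "flow \<gamma> (s + t) = flow \<gamma> s * flow \<gamma> t"
  by (simp add: flow_def vec_eq_iff algebra_simps flip: exp_add)

text \<open>
  Translations of the torus are isometries; this is what makes the Abel means below
  equicontinuous in the starting point.
\<close>

lemma dist_times_orbit_closure:
  assumes "w \<in> orbit_closure \<gamma>"
  shows "dist (z * w) (z' * w) = dist z z'"
proof -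
  have "norm ((z * w) $ j - (z' * w) $ j) = norm (z $ j - z' $ j)" for j
    using norm_orbit_closure_nth[OF assms, of j] by (simp add: norm_mult flip: left_diff_distrib)
  then show ?thesis by (simp add: dist_norm norm_vec_def)
qed

section \<open>Abel means along the orbit\<close>

text \<open>
  The exponential distribution: the weight \<open>\<epsilon> e\<^sup>-\<^sup>\<epsilon>\<^sup>y\<close> on \<open>[0,\<infinity>)\<close> that defines Abel means.
\<close>

definition abel_measure :: "real \<Rightarrow> real measure" where
  "abel_measure \<epsilon> = density lborel (exponential_density \<epsilon>)"

lemma sets_abel_measure [simp, measurable_cong]: "sets (abel_measure \<epsilon>) = sets borel"
  by (simp add: abel_measure_def)

lemma space_abel_measure [simp]: "space (abel_measure \<epsilon>) = UNIV"
  by (simp add: abel_measure_def)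

lemma prob_space_abel_measure: "\<epsilon> > 0 \<Longrightarrow> prob_space (abel_measure \<epsilon>)"
  unfolding abel_measure_def by (rule prob_space_exponential_density)

lemma integral_abel_measure:
  fixes g :: "real \<Rightarrow> 'b::{banach, second_countable_topology}"
  assumes "g \<in> borel_measurable borel" "\<epsilon> > 0"
  shows "(\<integral>y. g y \<partial>abel_measure \<epsilon>) = (\<integral>y. exponential_density \<epsilon> y *\<^sub>R g y \<partial>lborel)"
  unfolding abel_measure_def using assms
  by (subst integral_density) (auto simp: exponential_density_nonneg)

lemma integrable_abel_measure:
  fixes g :: "real \<Rightarrow> 'b::{banach, second_countable_topology}"
  assumes "g \<in> borel_measurable borel" "\<epsilon> > 0" "\<And>y. norm (g y) \<le> B"
  shows "integrable (abel_measure \<epsilon>) g"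
    and "integrable lborel (\<lambda>y. exponential_density \<epsilon> y *\<^sub>R g y)"
proof -
  interpret prob_space "abel_measure \<epsilon>" using assms(2) by (rule prob_space_abel_measure)
  show *: "integrable (abel_measure \<epsilon>) g"
    using assms by (intro integrable_const_bound[where B=B]) auto
  then show "integrable lborel (\<lambda>y. exponential_density \<epsilon> y *\<^sub>R g y)"
    unfolding abel_measure_def using assms
    by (subst (asm) integrable_density) (auto simp: exponential_density_nonneg)
qed

text \<open>
  The exponential density \<open>\<rho>\<close> satisfies \<open>\<rho>(y) = e\<^sup>-\<^sup>\<epsilon>\<^sup>s \<rho>(y - s)\<close> for \<open>y \<ge> s\<close>, so \<open>\<rho> - e\<^sup>-\<^sup>\<epsilon>\<^sup>s \<rho>(\<cdot> - s)\<close> is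
  nonnegative and its integral is \<open>1 - e\<^sup>-\<^sup>\<epsilon>\<^sup>s \<le> \<epsilon> s\<close>. Hence Abel means are asymptotically
  invariant under translation as \<open>\<epsilon>\<close> tends to \<open>0\<close>.
\<close>

lemma abel_measure_shift_nonneg:
  fixes g :: "real \<Rightarrow> 'b::{banach, second_countable_topology}"
  assumes [measurable]: "g \<in> borel_measurable borel" and \<epsilon>: "\<epsilon> > 0"
    and B: "\<And>y. norm (g y) \<le> B" and s: "s \<ge> 0"
  shows "norm ((\<integral>y. g (y + s) \<partial>abel_measure \<epsilon>) - (\<integral>y. g y \<partial>abel_measure \<epsilon>)) \<le> 2 * B * \<epsilon> * s"
proof -
  interpret prob_space "abel_measure \<epsilon>" using \<epsilon> by (rule prob_space_abel_measure)
  let ?\<rho> = "exponential_density \<epsilon>"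
  let ?q = "exp (- \<epsilon> * s)"
  have B0: "B \<ge> 0" using B[of 0] norm_ge_zero order.trans by blast
  have q: "0 < ?q" "?q \<le> 1" "1 - ?q \<le> \<epsilon> * s"
    using \<epsilon> s exp_ge_add_one_self[of "- \<epsilon> * s"] by auto
  have shift: "(\<integral>y. k (y + s) \<partial>abel_measure \<epsilon>) = (\<integral>y. ?\<rho> (y - s) *\<^sub>R k y \<partial>lborel)"
    "integrable lborel (\<lambda>y. ?\<rho> (y - s) *\<^sub>R k y)"
    if [measurable]: "k \<in> borel_measurable borel" and b: "\<And>y. norm (k y) \<le> B'" for k :: "real \<Rightarrow> 'c::{banach, second_countable_topology}" and B'
  proof -
    have "integrable lborel (\<lambda>y. ?\<rho> y *\<^sub>R k (y + s))"
      by (rule integrable_abel_measure(2)[OF _ \<epsilon>]) (use b in auto)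
    from lborel_integrable_real_affine[OF this, where c=1 and t="-s"]
    show "integrable lborel (\<lambda>y. ?\<rho> (y - s) *\<^sub>R k y)" by (simp add: algebra_simps)
    show "(\<integral>y. k (y + s) \<partial>abel_measure \<epsilon>) = (\<integral>y. ?\<rho> (y - s) *\<^sub>R k y \<partial>lborel)"
      using lborel_integral_real_affine[where c=1 and t="-s" and f="\<lambda>y. ?\<rho> y *\<^sub>R k (y + s)"] \<epsilon>
      by (subst integral_abel_measure) (auto simp: algebra_simps)
  qed
  have tail: "\<bar>?\<rho> y - ?q * ?\<rho> (y - s)\<bar> = ?\<rho> y - ?q * ?\<rho> (y - s)" for y
    using \<epsilon> s by (auto simp: exponential_density_def algebra_simps simp flip: exp_add)
  let ?I = "\<integral>y. g y \<partial>abel_measure \<epsilon>" and ?J = "\<integral>y. g (y + s) \<partial>abel_measure \<epsilon>"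
  have i1: "integrable lborel (\<lambda>y. ?\<rho> y *\<^sub>R g y)"
    by (rule integrable_abel_measure(2)[OF _ \<epsilon> B]) simp
  have i2: "integrable lborel (\<lambda>y. ?\<rho> (y - s) *\<^sub>R g y)"
    by (rule shift(2)[OF _ B]) simp
  have r1: "integrable lborel ?\<rho>" "(\<integral>y. ?\<rho> y \<partial>lborel) = 1"
    using integrable_abel_measure(2)[of "\<lambda>_. 1::real" \<epsilon> 1] integral_abel_measure[of "\<lambda>_. 1::real" \<epsilon>] \<epsilon> prob_space
    by auto
  have r2: "integrable lborel (\<lambda>y. ?\<rho> (y - s))" "(\<integral>y. ?\<rho> (y - s) \<partial>lborel) = 1"
    using shift[of "\<lambda>_. 1::real" 1] prob_space by auto
  have "?I - ?q *\<^sub>R ?J = (\<integral>y. (?\<rho> y - ?q * ?\<rho> (y - s)) *\<^sub>R g y \<partial>lborel)"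
    using i1 i2 \<epsilon> by (simp add: integral_abel_measure[of g] shift(1)[of g, OF _ B] scaleR_diff_left flip: scaleR_scaleR)
  also have "norm \<dots> \<le> (\<integral>y. (?\<rho> y - ?q * ?\<rho> (y - s)) * B \<partial>lborel)"
  proof (rule Bochner_Integration.integral_norm_bound_integral)
    show "integrable lborel (\<lambda>y. (?\<rho> y - ?q * ?\<rho> (y - s)) *\<^sub>R g y)"
      using i1 i2 by (simp add: scaleR_diff_left flip: scaleR_scaleR)
    show "integrable lborel (\<lambda>y. (?\<rho> y - ?q * ?\<rho> (y - s)) * B)"
      using r1 r2 by simp
    show "norm ((?\<rho> y - ?q * ?\<rho> (y - s)) *\<^sub>R g y) \<le> (?\<rho> y - ?q * ?\<rho> (y - s)) * B" for y
    proof -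
      have "0 \<le> ?\<rho> y - ?q * ?\<rho> (y - s)" using tail[of y] by linarith
      then show ?thesis using B[of y] by (simp add: mult_left_mono)
    qed
  qed
  also have "\<dots> = (1 - ?q) * B"
    using r1 r2 by simp
  finally have 1: "norm (?I - ?q *\<^sub>R ?J) \<le> (1 - ?q) * B" .
  have "norm ?J \<le> (\<integral>y. B \<partial>abel_measure \<epsilon>)"
    by (rule Bochner_Integration.integral_norm_bound_integral) (use integrable_abel_measure(1)[of "\<lambda>y. g (y + s)" \<epsilon> B] \<epsilon> B in auto)
  then have J: "norm ?J \<le> B" using prob_space by simp
  have "?J - ?I = (1 - ?q) *\<^sub>R ?J - (?I - ?q *\<^sub>R ?J)" by (simp add: scaleR_diff_left)
  then have "norm (?J - ?I) \<le> norm ((1 - ?q) *\<^sub>R ?J) + norm (?I - ?q *\<^sub>R ?J)"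
    by (metis norm_triangle_ineq4)
  also have "\<dots> \<le> (1 - ?q) * B + (1 - ?q) * B"
    using 1 J q by (intro add_mono) (auto intro: mult_left_mono)
  also have "\<dots> \<le> 2 * B * \<epsilon> * s"
    using mult_right_mono[OF q(3) B0] by (simp add: algebra_simps)
  finally show ?thesis .
qed

lemma abel_measure_shift:
  fixes g :: "real \<Rightarrow> 'b::{banach, second_countable_topology}"
  assumes [measurable]: "g \<in> borel_measurable borel" and \<epsilon>: "\<epsilon> > 0"
    and B: "\<And>y. norm (g y) \<le> B"
  shows "norm ((\<integral>y. g (y + s) \<partial>abel_measure \<epsilon>) - (\<integral>y. g y \<partial>abel_measure \<epsilon>)) \<le> 2 * B * \<epsilon> * \<bar>s\<bar>"
proof (cases "s \<ge> 0")
  case True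
  then show ?thesis using abel_measure_shift_nonneg[OF assms] by simp
next
  case False
  then show ?thesis
    using abel_measure_shift_nonneg[of "\<lambda>y. g (y + s)" \<epsilon> B "- s"] \<epsilon> B by (simp add: norm_minus_commute)
qed

text \<open>
  Let \<open>I\<^sub>n(z)\<close> be the mean of \<open>h\<close>
  along the orbit started at \<open>z\<close>, for the parameter \<open>\<epsilon> = X n\<close>. By Fubini and invariance, the
  average of \<open>I\<^sub>n\<close> over the group is the Haar integral of \<open>h\<close> for every \<open>n\<close>. On the other hand
  \<open>I\<^sub>n(z) - I\<^sub>n(1)\<close> tends to \<open>0\<close> for every \<open>z\<close>: up to a small error \<open>z\<close> lies on the orbit, and there
  the difference is that of a translation. Dominated convergence concludes.
\<close>

proposition abel_mean_flow:
  fixes \<gamma> :: "real ^ 'm" and h :: "complex ^ 'm \<Rightarrow> 'b::{banach, second_countable_topology}"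
  assumes h: "continuous_on UNIV h"
  shows "((\<lambda>\<epsilon>. \<integral>y. h (flow \<gamma> y) \<partial>abel_measure \<epsilon>) \<longlongrightarrow> (\<integral>z. h z \<partial>haar \<gamma>)) (at_right 0)"
  unfolding tendsto_at_iff_sequentially o_def
proof (intro allI impI)
  fix X :: "nat \<Rightarrow> real" assume "\<forall>i. X i \<in> {0<..} - {0}" and X0: "X \<longlonglongrightarrow> 0"
  then have X: "X n > 0" for n by auto
  let ?G = "orbit_closure \<gamma>" and ?M = "haar \<gamma>"
  interpret M: prob_space ?M by (rule prob_space_haar)
  obtain B where B: "B \<ge> 0" "\<And>z. z \<in> ?G \<Longrightarrow> norm (h z) \<le> B"
    using continuous_bounded_on_orbit_closure[OF h] by blast
  have [measurable]: "h \<in> borel_measurable borel" using h by (rule borel_measurable_continuous_onI)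
  have [measurable]: "flow \<gamma> \<in> borel_measurable borel"
    by (intro borel_measurable_continuous_onI continuous_flow)
  have idM[measurable]: "(\<lambda>z. z) \<in> borel_measurable ?M" by (rule borel_measurable_haar) simp
  have bnd: "norm (h (z * flow \<gamma> y)) \<le> B" if "z \<in> ?G" for z y
    using B(2) that flow_in_orbit_closure orbit_closure_times by blast
  define I where "I n z = (\<integral>y. h (z * flow \<gamma> y) \<partial>abel_measure (X n))" for n z
  have I_int: "integrable (abel_measure (X n)) (\<lambda>y. h (z * flow \<gamma> y))" if "z \<in> ?G" for z n
    by (rule integrable_abel_measure(1)[OF _ X bnd[OF that]]) simp
  have I_bound: "norm (I n z) \<le> B" if "z \<in> ?G" for z n
  proof -
    interpret prob_space "abel_measure (X n)" using X by (rule prob_space_abel_measure)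
    have "norm (I n z) \<le> (\<integral>y. B \<partial>abel_measure (X n))"
      unfolding I_def by (rule Bochner_Integration.integral_norm_bound_integral) (use I_int[OF that] bnd[OF that] in auto)
    then show ?thesis using prob_space by simp
  qed
  have I_meas[measurable]: "I n \<in> borel_measurable ?M" for n
  proof -
    interpret prob_space "abel_measure (X n)" using X by (rule prob_space_abel_measure)
    show ?thesis unfolding I_def by measurable
  qed
  have avg: "(\<integral>z. I n z \<partial>?M) = (\<integral>z. h z \<partial>?M)" for n
  proof -
    interpret P: prob_space "abel_measure (X n)" using X by (rule prob_space_abel_measure)
    interpret MP: pair_prob_space ?M "abel_measure (X n)" ..
    have "integrable (?M \<Otimes>\<^sub>M abel_measure (X n)) (\<lambda>(z, y). h (z * flow \<gamma> y))"
      using bnd by (intro MP.integrable_const_bound[where B=B]) (auto simp: space_pair_measure space_haar intro!: AE_I2)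
    then have "(\<integral>z. I n z \<partial>?M) = (\<integral>y. (\<integral>z. h (z * flow \<gamma> y) \<partial>?M) \<partial>abel_measure (X n))"
      unfolding I_def by (rule MP.Fubini_integral[symmetric])
    also have "\<dots> = (\<integral>y. (\<integral>z. h z \<partial>?M) \<partial>abel_measure (X n))"
      using integral_haar_translate[OF h flow_in_orbit_closure] by (simp add: mult.commute)
    finally show ?thesis using P.prob_space by simp
  qed
  have ptw: "(\<lambda>n. I n z - I n 1) \<longlonglongrightarrow> 0" if z: "z \<in> ?G" for z
  proof (rule LIMSEQ_I)
    fix e :: real assume e: "e > 0"
    have "uniformly_continuous_on ?G h"
      using h continuous_on_subset by (intro compact_uniformly_continuous compact_orbit_closure) auto
    then obtain d where d: "d > 0" "\<And>x y. x \<in> ?G \<Longrightarrow> y \<in> ?G \<Longrightarrow> dist x y < d \<Longrightarrow> dist (h x) (h y) < e / 2"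
      using e unfolding uniformly_continuous_on_def by (metis half_gt_zero dist_commute)
    obtain s where s: "dist (flow \<gamma> s) z < d"
      using z d(1) unfolding orbit_closure_def closure_approachable by blast
    have near: "norm (I n z - I n (flow \<gamma> s)) \<le> e / 2" for n
    proof -
      interpret P: prob_space "abel_measure (X n)" using X by (rule prob_space_abel_measure)
      have "I n z - I n (flow \<gamma> s) = (\<integral>y. h (z * flow \<gamma> y) - h (flow \<gamma> s * flow \<gamma> y) \<partial>abel_measure (X n))"
        unfolding I_def by (intro Bochner_Integration.integral_diff[symmetric] I_int z flow_in_orbit_closure)
      also have "norm \<dots> \<le> (\<integral>y. e / 2 \<partial>abel_measure (X n))"
      proof (rule Bochner_Integration.integral_norm_bound_integral)
        show "integrable (abel_measure (X n)) (\<lambda>y. h (z * flow \<gamma> y) - h (flow \<gamma> s * flow \<gamma> y))"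
          by (intro Bochner_Integration.integrable_diff I_int z flow_in_orbit_closure)
        fix y
        have "dist (h (z * flow \<gamma> y)) (h (flow \<gamma> s * flow \<gamma> y)) < e / 2"
          using s by (intro d orbit_closure_times z flow_in_orbit_closure)
            (simp add: dist_times_orbit_closure[OF flow_in_orbit_closure] dist_commute)
        then show "norm (h (z * flow \<gamma> y) - h (flow \<gamma> s * flow \<gamma> y)) \<le> e / 2"
          by (simp add: dist_norm)
      qed simp
      finally show ?thesis using P.prob_space by simp
    qed
    have shift: "norm (I n (flow \<gamma> s) - I n 1) \<le> 2 * B * X n * \<bar>s\<bar>" for n
      using abel_measure_shift[of "\<lambda>y. h (flow \<gamma> y)" "X n" B s, OF _ X B(2)[OF flow_in_orbit_closure]]
      by (simp add: I_def flow_add mult_ac)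
    have "(\<lambda>n. 2 * B * X n * \<bar>s\<bar>) \<longlonglongrightarrow> 2 * B * 0 * \<bar>s\<bar>"
      by (intro tendsto_intros X0)
    then have "\<forall>\<^sub>F n in sequentially. 2 * B * X n * \<bar>s\<bar> < e / 2"
      using e by (intro order_tendstoD) auto
    then show "\<exists>no. \<forall>n\<ge>no. norm (I n z - I n 1 - 0) < e"
      unfolding eventually_sequentially
    proof (elim exE, intro exI allI impI)
      fix no n assume *: "\<forall>n\<ge>no. 2 * B * X n * \<bar>s\<bar> < e / 2" "n \<ge> no"
      have "norm (I n z - I n 1) \<le> norm (I n z - I n (flow \<gamma> s)) + norm (I n (flow \<gamma> s) - I n 1)"
        by (rule norm_diff_triangle_le) auto
      also have "\<dots> < e" using near[of n] shift[of n] *(1)[rule_format, OF *(2)] by linarith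
      finally show "norm (I n z - I n 1 - 0) < e" by simp
    qed
  qed
  have "(\<lambda>n. \<integral>z. I n z - I n 1 \<partial>?M) \<longlonglongrightarrow> (\<integral>z. 0 \<partial>?M)"
  proof (rule integral_dominated_convergence[where w="\<lambda>_. 2 * B"])
    show "AE z in ?M. (\<lambda>n. I n z - I n 1) \<longlonglongrightarrow> 0" using ptw by (auto simp: space_haar)
    show "AE z in ?M. norm (I n z - I n 1) \<le> 2 * B" for n
    proof (rule AE_I2)
      fix z assume "z \<in> space ?M"
      then have "norm (I n z) \<le> B" "norm (I n 1) \<le> B"
        using I_bound one_in_orbit_closure by (auto simp: space_haar)
      then show "norm (I n z - I n 1) \<le> 2 * B" using norm_triangle_ineq4[of "I n z" "I n 1"] by linarith
    qed
  qed auto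
  moreover have "(\<integral>z. I n z - I n 1 \<partial>?M) = (\<integral>z. h z \<partial>?M) - I n 1" for n
  proof -
    have "integrable ?M (I n)"
      using I_bound by (intro M.integrable_const_bound[where B=B]) (auto simp: space_haar)
    then show ?thesis using M.prob_space avg[of n] by simp
  qed
  ultimately have "(\<lambda>n. (\<integral>z. h z \<partial>?M) - I n 1) \<longlonglongrightarrow> 0" by simp
  from tendsto_diff[OF tendsto_const[of "\<integral>z. h z \<partial>?M"] this] have "(\<lambda>n. I n 1) \<longlonglongrightarrow> (\<integral>z. h z \<partial>?M)"
    by simp
  then show "(\<lambda>n. \<integral>y. h (flow \<gamma> y) \<partial>abel_measure (X n)) \<longlonglongrightarrow> (\<integral>z. h z \<partial>?M)"
    by (simp add: I_def)
qed

section \<open>The moment problem on the orbit closure\<close>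

definition char_sum :: "complex ^ 'm \<Rightarrow> complex ^ 'm \<Rightarrow> complex" where
  "char_sum c z = (\<Sum>j\<in>UNIV. c $ j * z $ j)"

lemma continuous_char_sum [continuous_intros]: "continuous_on S (char_sum c)"
  unfolding char_sum_def by (intro continuous_intros)

lemma norm_char_sum_orbit_closure:
  fixes c :: "complex ^ 'm"
  assumes "z \<in> orbit_closure \<gamma>"
  shows "cmod (char_sum c z) \<le> (\<Sum>j\<in>UNIV. cmod (c $ j))"
  unfolding char_sum_def
  by (rule order.trans[OF norm_sum]) (simp add: norm_mult norm_orbit_closure_nth[OF assms])

lemma Re_inner_vec: "a \<bullet> c = Re (\<Sum>j\<in>UNIV. a $ j * cnj (c $ j))" for a c :: "complex ^ 'm"
  by (simp add: inner_vec_def inner_complex_def)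

lemma integral_times_cnj_char_sum:
  fixes a c :: "complex ^ 'm"
  assumes int: "\<And>j. integrable M (\<lambda>z. f z * cnj (z $ j))"
    and a: "\<And>j. (\<integral>z. f z * cnj (z $ j) \<partial>M) = a $ j"
  shows "integrable M (\<lambda>z. f z * cnj (char_sum c z))"
    and "a \<bullet> c = Re (\<integral>z. f z * cnj (char_sum c z) \<partial>M)"
proof -
  have eq: "f z * cnj (char_sum c z) = (\<Sum>j\<in>UNIV. cnj (c $ j) * (f z * cnj (z $ j)))" for z
    by (simp add: char_sum_def sum_distrib_left mult_ac)
  show "integrable M (\<lambda>z. f z * cnj (char_sum c z))"
    unfolding eq by (intro Bochner_Integration.integrable_sum integrable_mult_right int)
  have "(\<integral>z. f z * cnj (char_sum c z) \<partial>M) = (\<Sum>j\<in>UNIV. cnj (c $ j) * a $ j)"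
    unfolding eq by (subst Bochner_Integration.integral_sum) (use int a in auto)
  then show "a \<bullet> c = Re (\<integral>z. f z * cnj (char_sum c z) \<partial>M)"
    by (simp only: Re_inner_vec mult.commute)
qed

text \<open>
  Translation by \<open>w = flow \<gamma> t\<close> with \<open>t = \<pi> / (\<gamma>\<^sub>i - \<gamma>\<^sub>j)\<close> multiplies \<open>z\<^sub>i cnj z\<^sub>j\<close> by \<open>-1\<close>, so for
  distinct frequencies its invariant integral vanishes.
\<close>

lemma haar_characters_orthonormal:
  fixes \<gamma> :: "real ^ 'm"
  assumes "inj (\<lambda>j. \<gamma> $ j)"
  shows "(\<integral>z. z $ i * cnj (z $ j) \<partial>haar \<gamma>) = (if i = j then 1 else 0)"
proof (cases "i = j")
  case True
  interpret prob_space "haar \<gamma>" by (rule prob_space_haar)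
  have "(\<integral>z. z $ i * cnj (z $ j) \<partial>haar \<gamma>) = (\<integral>z. 1 \<partial>haar \<gamma>)"
    using True by (intro Bochner_Integration.integral_cong)
      (auto simp: space_haar norm_orbit_closure_nth simp flip: complex_norm_square)
  with True show ?thesis using prob_space by simp
next
  case False
  with assms have ne: "\<gamma> $ i - \<gamma> $ j \<noteq> 0" by (auto dest: injD)
  define t where "t = pi / (\<gamma> $ i - \<gamma> $ j)"
  let ?h = "\<lambda>z::complex ^ 'm. z $ i * cnj (z $ j)"
  let ?w = "flow \<gamma> t"
  have "?h ?w = exp (\<i> * complex_of_real (\<gamma> $ i * t - \<gamma> $ j * t))"
    by (simp add: flow_def exp_cnj ring_distribs flip: exp_add)
  also have "\<gamma> $ i * t - \<gamma> $ j * t = pi" 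
    using ne by (simp add: t_def left_diff_distrib[symmetric] diff_divide_distrib[symmetric])
  finally have w: "?h ?w = - 1" by simp
  have "(\<integral>z. ?h z \<partial>haar \<gamma>) = (\<integral>z. ?h (?w * z) \<partial>haar \<gamma>)"
    by (rule integral_haar_translate[symmetric]) (intro continuous_intros flow_in_orbit_closure)+
  also have "(\<lambda>z. ?h (?w * z)) = (\<lambda>z. ?h ?w * ?h z)" by (simp add: mult_ac)
  also have "(\<integral>z. ?h ?w * ?h z \<partial>haar \<gamma>) = - (\<integral>z. ?h z \<partial>haar \<gamma>)" by (simp add: w)
  finally show ?thesis using False by simp
qed

text \<open>
  Finite-dimensional duality: the displayed inequality says that \<open>a\<close> is not separated by a
  hyperplane from the convex set \<open>K\<close> of moment vectors of continuous functions of modulus at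
  most \<open>R\<close> on the group. The functions \<open>R p / (\<bar>p\<bar> + \<eta>)\<close> are continuous substitutes for
  \<open>R sgn p\<close>, and their pairing with \<open>p\<close> comes within \<open>R \<eta>\<close> of \<open>R \<integral>\<bar>p\<bar>\<close>. Hence \<open>a\<close> lies in the
  closure of \<open>K\<close>, and the small remaining error in the moments is removed by adding a
  combination of the orthonormal characters, at the cost of \<open>\<delta>\<close> in the bound.
\<close>

lemma interpolation_by_duality:
  fixes \<gamma> :: "real ^ 'm" and a :: "complex ^ 'm"
  assumes inj: "inj (\<lambda>j. \<gamma> $ j)" and R: "R \<ge> 0" and \<delta>: "\<delta> > 0"
    and dual: "\<And>c. a \<bullet> c \<le> R * (\<integral>z. cmod (char_sum c z) \<partial>haar \<gamma>)"
  obtains g where "continuous_on UNIV g" "\<And>z. z \<in> orbit_closure \<gamma> \<Longrightarrow> cmod (g z) \<le> R + \<delta>"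
    "\<And>j. (\<integral>z. g z * cnj (z $ j) \<partial>haar \<gamma>) = a $ j"
proof -
  let ?G = "orbit_closure \<gamma>" and ?M = "haar \<gamma>"
  interpret prob_space ?M by (rule prob_space_haar)
  define moments where "moments g = (\<chi> j. \<integral>z. g z * cnj (z $ j) \<partial>?M)" for g
  define K where "K = moments ` {g. continuous_on UNIV g \<and> (\<forall>z\<in>?G. cmod (g z) \<le> R)}"
  have int: "integrable ?M (\<lambda>z. g z * cnj (z $ j))" if "continuous_on UNIV g" for g j
    by (intro integrable_haar continuous_intros that)
  have "convex K"
  proof (rule convexI)
    fix x y and u v :: real assume "x \<in> K" "y \<in> K" and uv: "u \<ge> 0" "v \<ge> 0" "u + v = 1"
    then obtain g h where g: "continuous_on UNIV g" "\<And>z. z \<in> ?G \<Longrightarrow> cmod (g z) \<le> R" "x = moments g"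
      and h: "continuous_on UNIV h" "\<And>z. z \<in> ?G \<Longrightarrow> cmod (h z) \<le> R" "y = moments h"
      by (auto simp: K_def)
    have "u *\<^sub>R x + v *\<^sub>R y = moments (\<lambda>z. u *\<^sub>R g z + v *\<^sub>R h z)"
      using int[OF g(1)] int[OF h(1)] by (simp add: g h moments_def vec_eq_iff algebra_simps)
    moreover have "cmod (u *\<^sub>R g z + v *\<^sub>R h z) \<le> R" if "z \<in> ?G" for z
    proof -
      have "cmod (u *\<^sub>R g z + v *\<^sub>R h z) \<le> u * cmod (g z) + v * cmod (h z)"
        using uv by (intro order.trans[OF norm_triangle_ineq]) simp
      also have "\<dots> \<le> R" using uv g(2) h(2) that by (intro convex_bound_le) auto
      finally show ?thesis .
    qed
    ultimately show "u *\<^sub>R x + v *\<^sub>R y \<in> K"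
      unfolding K_def using g h by (auto intro!: imageI continuous_intros)
  qed
  have "a \<in> closure K"
  proof (rule ccontr)
    assume "a \<notin> closure K"
    then obtain c b where c: "c \<bullet> a < b" "\<And>x. x \<in> closure K \<Longrightarrow> c \<bullet> x > b"
      using separating_hyperplane_closed_point[of "closure K" a] \<open>convex K\<close> by (auto simp: convex_closure)
    let ?p = "char_sum (- c)"
    have est: "- b \<ge> R * (\<integral>z. cmod (?p z) \<partial>?M) - R * \<eta>" if \<eta>: "\<eta> > 0" for \<eta>
    proof -
      define g where "g z = R *\<^sub>R ?p z /\<^sub>R (cmod (?p z) + \<eta>)" for z
      have pos: "cmod (?p z) + \<eta> > 0" for z using \<eta> by (simp add: add_nonneg_pos)
      have g: "continuous_on UNIV g"
        unfolding g_def using pos by (intro continuous_intros) (auto simp: less_imp_neq[symmetric] dest: less_imp_neq)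
      have "cmod (g z) \<le> R" for z
        using R \<eta> pos[of z] by (simp add: g_def field_simps)
      with g have "moments g \<in> closure K" by (auto simp: K_def intro!: subsetD[OF closure_subset])
      then have "moments g \<bullet> (- c) < - b" using c(2)[of "moments g"] by (simp add: inner_commute)
      moreover have "moments g \<bullet> (- c) = Re (\<integral>z. g z * cnj (?p z) \<partial>?M)"
        by (rule integral_times_cnj_char_sum(2)[OF int[OF g]]) (simp add: moments_def)
      moreover have "Re (\<integral>z. g z * cnj (?p z) \<partial>?M) = (\<integral>z. Re (g z * cnj (?p z)) \<partial>?M)"
        by (rule integral_Re[symmetric]) (intro integrable_haar continuous_intros g)
      moreover have "(\<integral>z. R * cmod (?p z) - R * \<eta> \<partial>?M) \<le> (\<integral>z. Re (g z * cnj (?p z)) \<partial>?M)"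
      proof (rule integral_mono)
        fix z
        let ?x = "cmod (?p z)"
        have "?x - \<eta> \<le> ?x\<^sup>2 / (?x + \<eta>)"
          using pos[of z] by (simp add: field_simps power2_eq_square)
        then have "R * (?x - \<eta>) \<le> R * (?x\<^sup>2 / (?x + \<eta>))" by (intro mult_left_mono R)
        also have "\<dots> = Re (g z * cnj (?p z))"
        proof -
          have "g z * cnj (?p z) = complex_of_real (R / (?x + \<eta>)) * (?p z * cnj (?p z))"
            by (simp add: g_def scaleR_conv_of_real divide_inverse mult_ac)
          also have "\<dots> = complex_of_real (R / (?x + \<eta>) * ?x\<^sup>2)"
            by (simp only: complex_norm_square[symmetric] of_real_mult)
          finally show ?thesis by simp
        qed
        finally show "R * ?x - R * \<eta> \<le> Re (g z * cnj (?p z))" by (simp add: right_diff_distrib)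
      qed (intro integrable_haar continuous_intros g)+
      moreover have "(\<integral>z. R * cmod (?p z) - R * \<eta> \<partial>?M) = R * (\<integral>z. cmod (?p z) \<partial>?M) - R * \<eta>"
      proof -
        have "integrable ?M (\<lambda>z. cmod (?p z))" by (intro integrable_haar continuous_intros)
        then show ?thesis using prob_space by simp
      qed
      ultimately show ?thesis by linarith
    qed
    have "- b < R * (\<integral>z. cmod (?p z) \<partial>?M)"
      using c(1) dual[of "- c"] by (simp add: inner_commute)
    \<comment> \<open>A concrete \<open>\<eta>\<close> for which the error \<open>R \<eta>\<close> stays below the gap, also when \<open>R = 0\<close>.\<close>
    define d where "d = (R * (\<integral>z. cmod (?p z) \<partial>?M) + b) / (R + 1)"
    have "d > 0" using \<open>- b < _\<close> R by (simp add: d_def)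
    have "R * d < R * (\<integral>z. cmod (?p z) \<partial>?M) + b"
      using \<open>- b < _\<close> R by (simp add: d_def field_simps)
    with est[OF \<open>d > 0\<close>] show False by linarith
  qed
  define \<delta>' where "\<delta>' = \<delta> / real CARD('m)"
  have "\<delta>' > 0" using \<delta> by (simp add: \<delta>'_def)
  with \<open>a \<in> closure K\<close> obtain k where "k \<in> K" "dist k a < \<delta>'"
    unfolding closure_approachable by blast
  then obtain g where g: "continuous_on UNIV g" "\<And>z. z \<in> ?G \<Longrightarrow> cmod (g z) \<le> R" "k = moments g"
    by (auto simp: K_def)
  let ?b = "a - k"
  let ?g = "\<lambda>z. g z + char_sum ?b z"
  have "cmod (?g z) \<le> R + \<delta>" if z: "z \<in> ?G" for z
  proof -
    have "cmod (char_sum ?b z) \<le> (\<Sum>j\<in>UNIV. cmod (?b $ j))" by (rule norm_char_sum_orbit_closure[OF z])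
    also have "\<dots> \<le> (\<Sum>j\<in>(UNIV::'m set). \<delta>')"
    proof (rule sum_mono)
      fix j
      have "cmod (?b $ j) \<le> norm ?b" by (rule Finite_Cartesian_Product.norm_nth_le)
      then show "cmod (?b $ j) \<le> \<delta>'" using \<open>dist k a < \<delta>'\<close> by (simp add: dist_norm norm_minus_commute)
    qed
    also have "\<dots> = \<delta>" by (simp add: \<delta>'_def)
    finally show ?thesis using g(2)[OF z] norm_triangle_ineq[of "g z" "char_sum ?b z"] by linarith
  qed
  moreover have "(\<integral>z. ?g z * cnj (z $ j) \<partial>?M) = a $ j" for j
  proof -
    have i: "integrable ?M (\<lambda>z. ?b $ i * (z $ i * cnj (z $ j)))" for i
      by (intro integrable_haar continuous_intros)
    have "(\<integral>z. ?g z * cnj (z $ j) \<partial>?M)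
        = (\<integral>z. g z * cnj (z $ j) + (\<Sum>i\<in>UNIV. ?b $ i * (z $ i * cnj (z $ j))) \<partial>?M)"
      by (intro Bochner_Integration.integral_cong refl)
        (simp add: char_sum_def distrib_right sum_distrib_right mult.assoc)
    also have "\<dots> = k $ j + (\<Sum>i\<in>UNIV. \<integral>z. ?b $ i * (z $ i * cnj (z $ j)) \<partial>?M)"
      using int[OF g(1), of j] i
      by (subst Bochner_Integration.integral_add) (auto simp: g(3) moments_def Bochner_Integration.integral_sum)
    also have "(\<Sum>i\<in>UNIV. \<integral>z. ?b $ i * (z $ i * cnj (z $ j)) \<partial>?M) = (\<Sum>i\<in>UNIV. if i = j then ?b $ j else 0)"
      by (intro sum.cong refl) (simp add: haar_characters_orthonormal[OF inj])
    finally show ?thesis by simp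
  qed
  moreover have "continuous_on UNIV ?g" by (intro continuous_intros g)
  ultimately show thesis by (rule that[rotated 1])
qed

lemma dual_bound_of_bounded_function:
  fixes \<gamma> :: "real ^ 'm"
  assumes f: "f \<in> borel_measurable (haar \<gamma>)" and bd: "AE z in haar \<gamma>. cmod (f z) \<le> R"
    and a: "\<And>j. (\<integral>z. f z * cnj (z $ j) \<partial>haar \<gamma>) = a $ j"
  shows "a \<bullet> c \<le> R * (\<integral>z. cmod (char_sum c z) \<partial>haar \<gamma>)"
proof -
  interpret prob_space "haar \<gamma>" by (rule prob_space_haar)
  note [measurable] = f
  have int: "integrable (haar \<gamma>) (\<lambda>z. f z * cnj (z $ j))" for j
  proof (rule integrable_const_bound[where B=R])
    show "AE z in haar \<gamma>. cmod (f z * cnj (z $ j)) \<le> R"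
      using bd by (rule AE_mp) (auto simp: norm_mult space_haar norm_orbit_closure_nth intro!: AE_I2)
    have "(\<lambda>z. cnj (z $ j)) \<in> borel_measurable (haar \<gamma>)"
      by (intro borel_measurable_haar borel_measurable_continuous_onI continuous_intros)
    then show "(\<lambda>z. f z * cnj (z $ j)) \<in> borel_measurable (haar \<gamma>)" by measurable
  qed
  have "a \<bullet> c = Re (\<integral>z. f z * cnj (char_sum c z) \<partial>haar \<gamma>)"
    by (rule integral_times_cnj_char_sum(2)[OF int a])
  also have "\<dots> \<le> cmod (\<integral>z. f z * cnj (char_sum c z) \<partial>haar \<gamma>)" by (rule complex_Re_le_cmod)
  also have "\<dots> \<le> (\<integral>z. cmod (f z * cnj (char_sum c z)) \<partial>haar \<gamma>)" by (rule integral_norm_bound)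
  also have "\<dots> \<le> (\<integral>z. R * cmod (char_sum c z) \<partial>haar \<gamma>)"
  proof (rule integral_mono_AE)
    show "integrable (haar \<gamma>) (\<lambda>z. cmod (f z * cnj (char_sum c z)))"
      by (rule integrable_norm[OF integral_times_cnj_char_sum(1)[OF int a]])
    show "integrable (haar \<gamma>) (\<lambda>z. R * cmod (char_sum c z))"
      by (intro integrable_haar continuous_intros)
    show "AE z in haar \<gamma>. cmod (f z * cnj (char_sum c z)) \<le> R * cmod (char_sum c z)"
      using bd by eventually_elim (simp add: norm_mult mult_right_mono)
  qed
  finally show ?thesis by simp
qed

section \<open>Functions on the half-line\<close>

lemma abel_integral_eq_lebesgue:
  fixes g :: "real \<Rightarrow> 'b::{banach, second_countable_topology}"
  assumes [measurable]: "g \<in> borel_measurable borel" and "\<epsilon> > 0"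
  shows "(\<integral>y. g y \<partial>abel_measure \<epsilon>) = \<epsilon> *\<^sub>R (LINT y:{0..}|lebesgue. exp (- \<epsilon> * y) *\<^sub>R g y)"
proof -
  have "(\<integral>y. g y \<partial>abel_measure \<epsilon>) = (\<integral>y. \<epsilon> *\<^sub>R (indicator {0..} y *\<^sub>R exp (- \<epsilon> * y) *\<^sub>R g y) \<partial>lborel)"
    using assms by (subst integral_abel_measure)
      (auto simp: exponential_density_def indicator_def mult.commute intro!: Bochner_Integration.integral_cong)
  also have "\<dots> = \<epsilon> *\<^sub>R (\<integral>y. indicator {0..} y *\<^sub>R exp (- \<epsilon> * y) *\<^sub>R g y \<partial>lborel)"
    by (rule integral_scaleR_right)
  also have "(\<integral>y. indicator {0..} y *\<^sub>R exp (- \<epsilon> * y) *\<^sub>R g y \<partial>lborel)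
      = (LINT y:{0..}|lebesgue. exp (- \<epsilon> * y) *\<^sub>R g y)"
    unfolding set_lebesgue_integral_def by (rule integral_completion[symmetric]) measurable
  finally show ?thesis .
qed

text \<open>
  Absolute integrability in the Abel sense concerns only \<open>\<bar>F\<bar>\<close>; measurability of \<open>F\<close> itself
  comes from local integrability, by exhausting the half-line.
\<close>

lemma L1_loc_measurable:
  assumes "L1_loc F"
  shows "(\<lambda>y. indicator {0..} y *\<^sub>R F y) \<in> borel_measurable lebesgue"
proof (rule borel_measurable_LIMSEQ_metric)
  show "(\<lambda>y. indicator {0..real n} y *\<^sub>R F y) \<in> borel_measurable lebesgue" for n
  proof -
    have "set_integrable lebesgue {0..real n} F" using assms by (auto simp: L1_loc_def)
    then show ?thesis by (auto simp: set_integrable_def)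
  qed
  fix y :: real
  obtain N where "y \<le> real N" using real_arch_simple by blast
  then have "\<forall>\<^sub>F n in sequentially. indicator {0..real n} y *\<^sub>R F y = indicator {0..} y *\<^sub>R F y"
    by (intro eventually_sequentiallyI[of N]) (auto simp: indicator_def)
  then show "(\<lambda>n. indicator {0..real n} y *\<^sub>R F y) \<longlonglongrightarrow> indicator {0..} y *\<^sub>R F y"
    by (rule tendsto_eventually)
qed

lemma set_integrable_abel_times_bounded:
  assumes F: "L1_loc F" "abel_integrable F" and \<epsilon>: "\<epsilon> > 0"
    and k: "k \<in> borel_measurable borel" "\<And>y. cmod (k y) \<le> B"
  shows "set_integrable lebesgue {0..} (\<lambda>y. F y * complex_of_real (exp (- \<epsilon> * y)) * k y)"
proof -
  have "set_integrable lebesgue {0..} (\<lambda>y. cmod (F y) * exp (- \<epsilon> * y))"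
    using F(2) \<epsilon> by (auto simp: abel_integrable_def)
  then have "integrable lebesgue (\<lambda>y. B * (indicator {0..} y *\<^sub>R (cmod (F y) * exp (- \<epsilon> * y))))"
    unfolding set_integrable_def by (rule integrable_mult_right)
  moreover have "(\<lambda>y. indicator {0..} y *\<^sub>R (F y * complex_of_real (exp (- \<epsilon> * y)) * k y)) \<in> borel_measurable lebesgue"
  proof -
    have "(\<lambda>y. complex_of_real (exp (- \<epsilon> * y)) * k y) \<in> borel_measurable lebesgue"
      using k(1) by (intro measurable_completion) measurable
    then have "(\<lambda>y. (indicator {0..} y *\<^sub>R F y) * (complex_of_real (exp (- \<epsilon> * y)) * k y)) \<in> borel_measurable lebesgue"
      by (rule borel_measurable_times[OF L1_loc_measurable[OF F(1)]])
    then show ?thesis by (simp only: mult.assoc mult_scaleR_left)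
  qed
  moreover have "norm (indicator {0..} y *\<^sub>R (F y * complex_of_real (exp (- \<epsilon> * y)) * k y))
      \<le> norm (B * (indicator {0..} y *\<^sub>R (cmod (F y) * exp (- \<epsilon> * y))))" for y
  proof -
    have "B \<ge> 0" using k(2)[of 0] norm_ge_zero order.trans by blast
    then show ?thesis
      using mult_right_mono[OF k(2)[of y], of "cmod (F y) * exp (- \<epsilon> * y)"]
      by (simp add: norm_mult abs_mult indicator_def mult_ac)
  qed
  ultimately show ?thesis
    unfolding set_integrable_def by (rule Bochner_Integration.integrable_bound[OF _ _ AE_I2])
qed

text \<open>
  Tail essential suprema decrease, so their limit at infinity exists and is their infimum.
\<close>

lemma A_inf_eq_INF: "A_inf F = (INF Y. Linf_norm (restrict_space lebesgue {Y..}) F)"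
proof -
  let ?\<phi> = "\<lambda>Y. Linf_norm (restrict_space lebesgue {Y..}) F"
  have mono: "?\<phi> Y' \<le> ?\<phi> Y" if "Y \<le> Y'" for Y Y' :: real
  proof (cases "(\<lambda>y. ennreal (cmod (F y))) \<in> borel_measurable (restrict_space lebesgue {Y..})")
    case True
    have sub: "restrict_space (restrict_space lebesgue {Y..}) {Y'..} = restrict_space lebesgue {Y'..}"
      using that by (subst restrict_restrict_space) (auto intro!: arg_cong[where f="restrict_space lebesgue"])
    have "AE y in restrict_space lebesgue {Y..}. ennreal (cmod (F y)) \<le> ?\<phi> Y"
      unfolding Linf_norm_def by (rule esssup_AE)
    then have "AE y in restrict_space lebesgue {Y'..}. ennreal (cmod (F y)) \<le> ?\<phi> Y"
      using that by (auto simp: AE_restrict_space_iff elim!: eventually_mono)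
    moreover have "(\<lambda>y. ennreal (cmod (F y))) \<in> borel_measurable (restrict_space lebesgue {Y'..})"
      using measurable_restrict_space1[OF True, of "{Y'..}"] by (simp add: sub)
    ultimately show ?thesis unfolding Linf_norm_def[of "restrict_space lebesgue {Y'..}"] by (intro esssup_I)
  next
    case False
    then show ?thesis by (simp add: Linf_norm_def esssup_non_measurable)
  qed
  have "(?\<phi> \<longlongrightarrow> (INF Y. ?\<phi> Y)) at_top"
  proof (rule order_tendstoI)
    fix l assume "l < (INF Y. ?\<phi> Y)"
    then show "\<forall>\<^sub>F Y in at_top. l < ?\<phi> Y" by (intro always_eventually) (auto intro: less_INF_D)
  next
    fix u assume "(INF Y. ?\<phi> Y) < u"
    then obtain Y where "?\<phi> Y < u" by (auto simp: INF_less_iff)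
    then show "\<forall>\<^sub>F Y in at_top. ?\<phi> Y < u"
      using mono order.strict_trans1 by (intro eventually_at_top_linorderI[of Y]) blast
  qed
  then show ?thesis unfolding A_inf_def by (intro tendsto_Lim) auto
qed

lemma A_inf_less_imp_eventually_bounded:
  assumes "A_inf F < ennreal R" "R \<ge> 0"
  obtains Y where "Y \<ge> 0" "AE y in lebesgue. y \<ge> Y \<longrightarrow> cmod (F y) \<le> R"
proof -
  obtain Y where Y: "Linf_norm (restrict_space lebesgue {Y..}) F < ennreal R"
    using assms(1) by (auto simp: A_inf_eq_INF INF_less_iff)
  have "AE y in restrict_space lebesgue {Y..}. ennreal (cmod (F y)) \<le> Linf_norm (restrict_space lebesgue {Y..}) F"
    unfolding Linf_norm_def by (rule esssup_AE)
  then have "AE y in lebesgue. y \<ge> Y \<longrightarrow> ennreal (cmod (F y)) \<le> Linf_norm (restrict_space lebesgue {Y..}) F"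
    by (simp add: AE_restrict_space_iff)
  then have "AE y in lebesgue. y \<ge> max 0 Y \<longrightarrow> cmod (F y) \<le> R"
  proof (rule eventually_mono)
    fix y assume *: "Y \<le> y \<longrightarrow> ennreal (cmod (F y)) \<le> Linf_norm (restrict_space lebesgue {Y..}) F"
    show "max 0 Y \<le> y \<longrightarrow> cmod (F y) \<le> R"
    proof
      assume "max 0 Y \<le> y"
      with * Y have "ennreal (cmod (F y)) \<le> ennreal R" by simp
      then show "cmod (F y) \<le> R" using assms(2) by simp
    qed
  qed
  then show thesis by (intro that[of "max 0 Y"]) auto
qed

lemma cnj_flow_nth: "cnj (flow \<gamma> y $ j) = exp (- \<i> * complex_of_real (\<gamma> $ j * y))"
  by (simp add: flow_def exp_cnj)

text \<open>
  Pairing the Abel coefficients with \<open>c\<close> gives the limit of the Abel means \<open>\<Phi>\<close> of \<open>F cnj w\<close>,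
  where \<open>w\<close> is \<open>p\<^sub>c\<close>, the character sum with coefficients \<open>c\<close>, read along the orbit.
  The part of \<open>F\<close> on \<open>[0,Y]\<close> contributes \<open>O(\<epsilon>)\<close>, and \<open>\<bar>F\<bar> \<le> R\<close> almost everywhere beyond \<open>Y\<close>; so
  \<open>\<bar>\<Phi>\<bar>\<close> is at most \<open>R\<close> times the Abel
  mean of \<open>\<bar>w\<bar>\<close>, up to \<open>O(\<epsilon>)\<close>, and that mean tends to the Haar integral of \<open>\<bar>p\<^sub>c\<bar>\<close>.
\<close>

lemma dual_bound_of_abel_coeffs:
  fixes \<gamma> :: "real ^ 'm"
  assumes F: "L1_loc F" "abel_integrable F" and coeffs: "has_abel_coeffs \<gamma> F a"
    and R: "A_inf F < ennreal R" "R \<ge> 0"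
  shows "a \<bullet> c \<le> R * (\<integral>z. cmod (char_sum c z) \<partial>haar \<gamma>)"
proof -
  obtain Y where Y: "Y \<ge> 0" "AE y in lebesgue. y \<ge> Y \<longrightarrow> cmod (F y) \<le> R"
    using A_inf_less_imp_eventually_bounded[OF R] by blast
  define w where "w y = char_sum c (flow \<gamma> y)" for y
  define B where "B = (\<Sum>j\<in>UNIV. cmod (c $ j))"
  have wB: "cmod (w y) \<le> B" for y
    unfolding w_def B_def by (rule norm_char_sum_orbit_closure[OF flow_in_orbit_closure])
  have [measurable]: "w \<in> borel_measurable borel" "(\<lambda>y. cnj (w y)) \<in> borel_measurable borel"
    "(\<lambda>y. cnj (flow \<gamma> y $ j)) \<in> borel_measurable borel" for j
    unfolding w_def char_sum_def flow_def vec_lambda_beta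
    by (intro borel_measurable_continuous_onI continuous_intros)+
  define \<Phi> where "\<Phi> \<epsilon> = complex_of_real \<epsilon> *
    (LINT y:{0..}|lebesgue. F y * complex_of_real (exp (- \<epsilon> * y)) * cnj (w y))" for \<epsilon> :: real
  have "(\<Phi> \<longlongrightarrow> (\<Sum>j\<in>UNIV. cnj (c $ j) * a $ j)) (at_right 0)"
  proof (rule Lim_transform_eventually)
    let ?L = "\<lambda>\<epsilon> j. LINT y:{0..}|lebesgue. F y * complex_of_real (exp (- \<epsilon> * y)) * cnj (flow \<gamma> y $ j)"
    show "((\<lambda>\<epsilon>. \<Sum>j\<in>UNIV. cnj (c $ j) * (complex_of_real \<epsilon> * ?L \<epsilon> j)) \<longlongrightarrow> (\<Sum>j\<in>UNIV. cnj (c $ j) * a $ j)) (at_right 0)"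
      unfolding cnj_flow_nth using coeffs unfolding has_abel_coeffs_def by (intro tendsto_intros) blast
    have "(\<Sum>j\<in>UNIV. cnj (c $ j) * (complex_of_real \<epsilon> * ?L \<epsilon> j)) = \<Phi> \<epsilon>" if "\<epsilon> > 0" for \<epsilon>
    proof -
      have i: "set_integrable lebesgue {0..} (\<lambda>y. F y * complex_of_real (exp (- \<epsilon> * y)) * cnj (flow \<gamma> y $ j))" for j
        by (rule set_integrable_abel_times_bounded[OF F that, where B=1])
          (simp_all add: norm_orbit_closure_nth[OF flow_in_orbit_closure[of \<gamma>]])
      have "(LINT y:{0..}|lebesgue. F y * complex_of_real (exp (- \<epsilon> * y)) * cnj (w y))
        = (LINT y:{0..}|lebesgue. \<Sum>j\<in>UNIV. cnj (c $ j) * (F y * complex_of_real (exp (- \<epsilon> * y)) * cnj (flow \<gamma> y $ j)))"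
        by (simp add: w_def char_sum_def sum_distrib_left mult_ac)
      also have "\<dots> = (\<Sum>j\<in>UNIV. cnj (c $ j) * ?L \<epsilon> j)"
        using i unfolding set_lebesgue_integral_def set_integrable_def
        by (simp add: scaleR_sum_right Bochner_Integration.integral_sum flip: mult_scaleR_right)
      finally show ?thesis by (simp add: \<Phi>_def sum_distrib_left mult_ac)
    qed
    then show "\<forall>\<^sub>F \<epsilon> in at_right 0. (\<Sum>j\<in>UNIV. cnj (c $ j) * (complex_of_real \<epsilon> * ?L \<epsilon> j)) = \<Phi> \<epsilon>"
      by (auto simp: eventually_at_right_less eventually_at_filter)
  qed
  then have lim1: "((\<lambda>\<epsilon>. cmod (\<Phi> \<epsilon>)) \<longlongrightarrow> cmod (\<Sum>j\<in>UNIV. cnj (c $ j) * a $ j)) (at_right 0)"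
    by (rule tendsto_norm)
  define C where "C = B * (LINT y:{0..Y}|lebesgue. cmod (F y))"
  have "((\<lambda>\<epsilon>. \<integral>y. cmod (w y) \<partial>abel_measure \<epsilon>) \<longlongrightarrow> (\<integral>z. cmod (char_sum c z) \<partial>haar \<gamma>)) (at_right 0)"
    unfolding w_def by (intro abel_mean_flow continuous_intros)
  then have "((\<lambda>\<epsilon>. \<epsilon> * C + R * (\<integral>y. cmod (w y) \<partial>abel_measure \<epsilon>)) \<longlongrightarrow> 0 * C + R * (\<integral>z. cmod (char_sum c z) \<partial>haar \<gamma>)) (at_right 0)"
    by (intro tendsto_intros)
  moreover have "cmod (\<Phi> \<epsilon>) \<le> \<epsilon> * C + R * (\<integral>y. cmod (w y) \<partial>abel_measure \<epsilon>)" if \<epsilon>: "\<epsilon> > 0" for \<epsilon>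
  proof -
    let ?f = "\<lambda>y. indicator {0..} y *\<^sub>R (F y * complex_of_real (exp (- \<epsilon> * y)) * cnj (w y))"
    let ?g1 = "\<lambda>y. B * (indicator {0..Y} y *\<^sub>R cmod (F y))"
    let ?g2 = "\<lambda>y. R * (indicator {0..} y *\<^sub>R exp (- \<epsilon> * y) *\<^sub>R cmod (w y))"
    have f: "integrable lebesgue ?f"
      unfolding set_integrable_def[symmetric]
      by (rule set_integrable_abel_times_bounded[OF F \<epsilon>, where B=B]) (simp_all add: wB)
    have "set_integrable lebesgue {0..Y} F" using F(1) by (auto simp: L1_loc_def)
    then have g1: "integrable lebesgue ?g1"
      unfolding set_integrable_def by (intro integrable_mult_right) (auto dest: integrable_norm)
    have g2: "integrable lebesgue ?g2"
    proof -
      have "integrable lborel (\<lambda>y. exponential_density \<epsilon> y *\<^sub>R cmod (w y))"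
        by (rule integrable_abel_measure(2)[OF _ \<epsilon>, where B=B]) (use wB in auto)
      then have "integrable lborel (\<lambda>y. (R / \<epsilon>) * (exponential_density \<epsilon> y *\<^sub>R cmod (w y)))"
        by (rule integrable_mult_right)
      also have "(\<lambda>y. (R / \<epsilon>) * (exponential_density \<epsilon> y *\<^sub>R cmod (w y))) = ?g2"
        using \<epsilon> by (auto simp: fun_eq_iff exponential_density_def indicator_def mult.commute)
      finally show ?thesis by (subst integrable_completion) auto
    qed
    have "cmod (\<integral>y. ?f y \<partial>lebesgue) \<le> (\<integral>y. norm (?f y) \<partial>lebesgue)" by (rule integral_norm_bound)
    also have "\<dots> \<le> (\<integral>y. ?g1 y + ?g2 y \<partial>lebesgue)"
    proof (rule integral_mono_AE)
      show "integrable lebesgue (\<lambda>y. norm (?f y))" using f by (rule integrable_norm)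
      show "integrable lebesgue (\<lambda>y. ?g1 y + ?g2 y)" using g1 g2 by (rule Bochner_Integration.integrable_add)
      show "AE y in lebesgue. norm (?f y) \<le> ?g1 y + ?g2 y"
        using Y(2)
      proof (rule eventually_mono)
        fix y assume y: "Y \<le> y \<longrightarrow> cmod (F y) \<le> R"
        have B0: "B \<ge> 0" using wB[of 0] norm_ge_zero order.trans by blast
        have g20: "?g2 y \<ge> 0" using R(2) by simp
        have g10: "?g1 y \<ge> 0" using B0 by simp
        consider "y < 0" | "0 \<le> y" "y \<le> Y" | "Y < y" "0 \<le> y" using Y(1) by linarith
        then show "norm (?f y) \<le> ?g1 y + ?g2 y"
        proof cases
          case 1
          then show ?thesis using Y(1) by simp
        next
          case 2
          have "exp (- \<epsilon> * y) * cmod (w y) \<le> 1 * B"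
            using \<epsilon> 2(1) wB[of y] by (intro mult_mono) auto
          then have "cmod (F y) * (exp (- \<epsilon> * y) * cmod (w y)) \<le> cmod (F y) * B"
            by (intro mult_left_mono) auto
          then have "norm (?f y) \<le> ?g1 y" using 2 by (simp add: norm_mult mult_ac)
          then show ?thesis using g20 by linarith
        next
          case 3
          have "cmod (F y) * (exp (- \<epsilon> * y) * cmod (w y)) \<le> R * (exp (- \<epsilon> * y) * cmod (w y))"
            using y 3 by (intro mult_right_mono) auto
          then have "norm (?f y) \<le> ?g2 y" using 3 by (simp add: norm_mult mult_ac)
          then show ?thesis using g10 by linarith
        qed
      qed
    qed
    also have "\<dots> = C + R * (LINT y:{0..}|lebesgue. exp (- \<epsilon> * y) *\<^sub>R cmod (w y))"
      using g1 g2 by (simp add: C_def set_lebesgue_integral_def)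
    finally have "cmod (\<integral>y. ?f y \<partial>lebesgue) \<le> \<dots>" .
    then have "\<epsilon> * cmod (\<integral>y. ?f y \<partial>lebesgue) \<le> \<epsilon> * (C + R * (LINT y:{0..}|lebesgue. exp (- \<epsilon> * y) *\<^sub>R cmod (w y)))"
      using \<epsilon> by (intro mult_left_mono) auto
    moreover have "cmod (\<Phi> \<epsilon>) = \<epsilon> * cmod (\<integral>y. ?f y \<partial>lebesgue)"
      using \<epsilon> by (simp add: \<Phi>_def norm_mult set_lebesgue_integral_def)
    moreover have "(\<integral>y. cmod (w y) \<partial>abel_measure \<epsilon>) = \<epsilon> * (LINT y:{0..}|lebesgue. exp (- \<epsilon> * y) *\<^sub>R cmod (w y))"
      using abel_integral_eq_lebesgue[of "\<lambda>y. cmod (w y)" \<epsilon>] \<epsilon> by simp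
    ultimately show ?thesis by (simp only: distrib_left mult.left_commute)
  qed
  then have "\<forall>\<^sub>F \<epsilon> in at_right 0. cmod (\<Phi> \<epsilon>) \<le> \<epsilon> * C + R * (\<integral>y. cmod (w y) \<partial>abel_measure \<epsilon>)"
    by (auto simp: eventually_at_filter)
  ultimately have "cmod (\<Sum>j\<in>UNIV. cnj (c $ j) * a $ j) \<le> 0 * C + R * (\<integral>z. cmod (char_sum c z) \<partial>haar \<gamma>)"
    using lim1 by (intro tendsto_le[of "at_right (0::real)"]) auto
  moreover have "a \<bullet> c \<le> cmod (\<Sum>j\<in>UNIV. cnj (c $ j) * a $ j)"
    unfolding Re_inner_vec using complex_Re_le_cmod by (simp only: mult.commute)
  ultimately show ?thesis by simp
qed

section \<open>The extremal problem\<close>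

lemma q_min_le:
  fixes \<gamma> :: "real ^ 'm"
  assumes g: "continuous_on UNIV g" "\<And>z. z \<in> orbit_closure \<gamma> \<Longrightarrow> cmod (g z) \<le> R"
    and a: "\<And>j. (\<integral>z. g z * cnj (z $ j) \<partial>haar \<gamma>) = a $ j"
  shows "q_min \<gamma> a \<le> ennreal R"
proof -
  have m[measurable]: "g \<in> borel_measurable (haar \<gamma>)"
    using g(1) by (intro borel_measurable_haar borel_measurable_continuous_onI)
  have le: "Linf_norm (haar \<gamma>) g \<le> ennreal R"
    unfolding Linf_norm_def using g(2) by (intro esssup_I AE_I2) (auto simp: space_haar ennreal_leI)
  then have "Linf_norm (haar \<gamma>) g < \<infinity>" by (rule order.strict_trans1) simp
  then have "q_min \<gamma> a \<le> Linf_norm (haar \<gamma>) g"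
    unfolding q_min_def using m a by (intro Inf_lower) blast
  with le show ?thesis by simp
qed

text \<open>
  Sampling a continuous function on the group along the orbit turns its Fourier coefficients
  at the coordinate characters into Abel coefficients.
\<close>

lemma restriction_to_orbit_admissible:
  fixes \<gamma> :: "real ^ 'm"
  assumes g: "continuous_on UNIV g" "\<And>z. z \<in> orbit_closure \<gamma> \<Longrightarrow> cmod (g z) \<le> R"
    and a: "\<And>j. (\<integral>z. g z * cnj (z $ j) \<partial>haar \<gamma>) = a $ j"
  defines "F \<equiv> \<lambda>y. g (flow \<gamma> y)"
  shows "L1_loc F" "abel_integrable F" "has_abel_coeffs \<gamma> F a" "A_inf F \<le> ennreal R"
proof -
  have cF: "continuous_on S F" for S
    unfolding F_def by (rule continuous_on_compose2[OF g(1) continuous_flow]) auto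
  have [measurable]: "F \<in> borel_measurable borel" by (intro borel_measurable_continuous_onI cF)
  have FR: "cmod (F y) \<le> R" for y unfolding F_def by (intro g flow_in_orbit_closure)
  show "L1_loc F"
    unfolding L1_loc_def
  proof (intro allI impI)
    fix K :: "real set" assume K: "compact K \<and> K \<subseteq> {0..}"
    have "integrable lborel (\<lambda>y. indicator K y *\<^sub>R F y)"
      using K cF by (intro borel_integrable_compact) auto
    moreover have [measurable]: "K \<in> sets borel" using K by (simp add: borel_compact)
    ultimately show "set_integrable lebesgue K F"
      unfolding set_integrable_def by (subst integrable_completion) auto
  qed
  show "abel_integrable F"
    unfolding abel_integrable_def
  proof (intro allI impI)
    fix \<epsilon> :: real assume \<epsilon>: "\<epsilon> > 0"
    have "integrable lborel (\<lambda>y. exponential_density \<epsilon> y *\<^sub>R cmod (F y))"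
      by (rule integrable_abel_measure(2)[OF _ \<epsilon>, where B=R]) (use FR in auto)
    then have "integrable lborel (\<lambda>y. (1 / \<epsilon>) * (exponential_density \<epsilon> y *\<^sub>R cmod (F y)))"
      by (rule integrable_mult_right)
    also have "(\<lambda>y. (1 / \<epsilon>) * (exponential_density \<epsilon> y *\<^sub>R cmod (F y)))
        = (\<lambda>y. indicator {0..} y *\<^sub>R (cmod (F y) * exp (- \<epsilon> * y)))"
      using \<epsilon> by (auto simp: fun_eq_iff exponential_density_def indicator_def mult.commute)
    finally show "set_integrable lebesgue {0..} (\<lambda>y. cmod (F y) * exp (- \<epsilon> * y))"
      unfolding set_integrable_def by (subst integrable_completion) auto
  qed
  show "has_abel_coeffs \<gamma> F a"
    unfolding has_abel_coeffs_def
  proof (rule allI, rule Lim_transform_eventually)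
    fix j
    let ?h = "\<lambda>z. g z * cnj (z $ j)"
    have h: "continuous_on UNIV ?h" by (intro continuous_intros g)
    show "((\<lambda>\<epsilon>. \<integral>y. ?h (flow \<gamma> y) \<partial>abel_measure \<epsilon>) \<longlongrightarrow> a $ j) (at_right 0)"
      using abel_mean_flow[OF h, of \<gamma>] a by simp
    have [measurable]: "(\<lambda>y. ?h (flow \<gamma> y)) \<in> borel_measurable borel"
      by (intro borel_measurable_continuous_onI continuous_on_compose2[OF h continuous_flow]) auto
    have "(\<integral>y. ?h (flow \<gamma> y) \<partial>abel_measure \<epsilon>) = complex_of_real \<epsilon> *
        (LINT y:{0..}|lebesgue. F y * complex_of_real (exp (- \<epsilon> * y)) *
           exp (- \<i> * complex_of_real (\<gamma> $ j * y)))" if "\<epsilon> > 0" for \<epsilon>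
      using that unfolding cnj_flow_nth[symmetric]
      by (subst abel_integral_eq_lebesgue) (auto simp: F_def scaleR_conv_of_real mult_ac)
    then show "\<forall>\<^sub>F \<epsilon> in at_right 0. (\<integral>y. ?h (flow \<gamma> y) \<partial>abel_measure \<epsilon>) = complex_of_real \<epsilon> *
        (LINT y:{0..}|lebesgue. F y * complex_of_real (exp (- \<epsilon> * y)) *
           exp (- \<i> * complex_of_real (\<gamma> $ j * y)))"
      by (auto simp: eventually_at_filter)
  qed
  have "(\<lambda>y. ennreal (cmod (F y))) \<in> borel_measurable (restrict_space lebesgue {0..})"
    by (intro measurable_restrict_space1 measurable_completion) measurable
  then have "Linf_norm (restrict_space lebesgue {0..}) F \<le> ennreal R"
    unfolding Linf_norm_def using FR by (intro esssup_I AE_I2 ennreal_leI)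
  then show "A_inf F \<le> ennreal R"
    unfolding A_inf_eq_INF by (rule INF_lower2[OF UNIV_I])
qed

theorem theorem33p2:
  fixes \<gamma> :: "real ^ 'm"
  assumes "inj (\<lambda>j. \<gamma> $ j)"
  shows "(\<forall>F a. L1_loc F \<longrightarrow> abel_integrable F \<longrightarrow> has_abel_coeffs \<gamma> F a
              \<longrightarrow> A_inf F \<ge> q_min \<gamma> a) \<and>
         (\<forall>a. q_min \<gamma> a =
              Inf {A_inf F | F. L1_loc F \<and> abel_integrable F \<and> has_abel_coeffs \<gamma> F a})"
proof -
  have lower: "q_min \<gamma> a \<le> A_inf F"
    if F: "L1_loc F" "abel_integrable F" "has_abel_coeffs \<gamma> F a" for F a
  proof (rule ennreal_le_epsilon)
    fix e :: real assume fin: "A_inf F < top" and e: "0 < e"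
    \<comment> \<open>Half of \<open>e\<close> makes the bound on \<open>F\<close> strict, the other half pays for the interpolation.\<close>
    define R where "R = enn2real (A_inf F) + e / 2"
    have R: "R \<ge> 0" using e by (simp add: R_def)
    have A: "A_inf F = ennreal (enn2real (A_inf F))" using fin by simp
    have "A_inf F < ennreal R" unfolding R_def by (subst A) (use e in \<open>simp add: ennreal_less_iff\<close>)
    from dual_bound_of_abel_coeffs[OF F this R]
    obtain g where "continuous_on UNIV g" "\<And>z. z \<in> orbit_closure \<gamma> \<Longrightarrow> cmod (g z) \<le> R + e / 2"
      "\<And>j. (\<integral>z. g z * cnj (z $ j) \<partial>haar \<gamma>) = a $ j"
      using interpolation_by_duality[OF assms R, of "e / 2" a] e by auto
    then have "q_min \<gamma> a \<le> ennreal (R + e / 2)" by (rule q_min_le)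
    also have "\<dots> = A_inf F + ennreal e"
      by (subst A) (use e in \<open>simp add: R_def flip: ennreal_plus\<close>)
    finally show "q_min \<gamma> a \<le> A_inf F + ennreal e" .
  qed
  have upper: "Inf {A_inf F | F. L1_loc F \<and> abel_integrable F \<and> has_abel_coeffs \<gamma> F a} \<le> q_min \<gamma> a"
    (is "?I \<le> _") for a
    unfolding q_min_def
  proof (rule Inf_greatest, elim CollectE exE conjE, hypsubst)
    fix f assume f: "f \<in> borel_measurable (haar \<gamma>)" and fin: "Linf_norm (haar \<gamma>) f < \<infinity>"
      and a: "\<forall>j. (\<integral>z. f z * cnj (z $ j) \<partial>haar \<gamma>) = a $ j"
    define R where "R = enn2real (Linf_norm (haar \<gamma>) f)"
    have R: "R \<ge> 0" "Linf_norm (haar \<gamma>) f = ennreal R" using fin by (auto simp: R_def)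
    have "AE z in haar \<gamma>. ennreal (cmod (f z)) \<le> Linf_norm (haar \<gamma>) f"
      unfolding Linf_norm_def by (rule esssup_AE)
    then have bd: "AE z in haar \<gamma>. cmod (f z) \<le> R" using R by simp
    show "?I \<le> Linf_norm (haar \<gamma>) f"
    proof (rule ennreal_le_epsilon)
      fix e :: real assume e: "0 < e"
      obtain g where "continuous_on UNIV g" "\<And>z. z \<in> orbit_closure \<gamma> \<Longrightarrow> cmod (g z) \<le> R + e"
        "\<And>j. (\<integral>z. g z * cnj (z $ j) \<partial>haar \<gamma>) = a $ j"
        using interpolation_by_duality[OF assms R(1) e dual_bound_of_bounded_function[OF f bd]] a by blast
      note F = restriction_to_orbit_admissible[OF this]
      have "?I \<le> A_inf (\<lambda>y. g (flow \<gamma> y))" using F by (intro Inf_lower) blast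
      also have "\<dots> \<le> ennreal (R + e)" by (rule F)
      also have "\<dots> = Linf_norm (haar \<gamma>) f + ennreal e" using R e by simp
      finally show "?I \<le> Linf_norm (haar \<gamma>) f + ennreal e" .
    qed
  qed
  show ?thesis
  proof (intro conjI allI impI)
    fix a
    show "q_min \<gamma> a = Inf {A_inf F | F. L1_loc F \<and> abel_integrable F \<and> has_abel_coeffs \<gamma> F a}"
      using lower by (intro antisym upper Inf_greatest) blast
  qed (rule lower)
qed

end
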